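(* Let $\mathcal{L}$ be a finite FOLDS signature, $\mathbb{T}$ a FOLDS $\mathcal{L}$-theory and $\tau$ an $\mathcal{L}$-sequent. If $\mathbb{T}\vdash\tau$ then $\mathbb{T}\models\tau$; and if $\mathbb{T}\vdash_{\mathrm{cl}}\tau$ then $\mathbb{T}\models_{\mathrm{cl}}\tau$.
   Context: A FOLDS signature is an inverse category $\mathcal{L}$ (skeletal, no non-identity endomorphisms, each object the domain of finitely many arrows) with a proper order: a partial order $<$ on objects with $K_f<K$ for every non-identity $f\colon K\to K_f$, and a partial order on arrows with $f<g$ whenever $\operatorname{cod}f<\operatorname{cod}g$; $K/\!/\mathcal{L}$ is the set of non-identity arrows with domain $K$, $K_f$ the codomain of $f$, indexed tuples listed in increasing order. Syntax: sorts $A(x_f)_{f\in A/\!/\mathcal{L}}$; contexts $x_1:K_1,\dots,x_n:K_n$, well-formed when each sort $K_i$ is formed (by the rule: $K(x_f)_f$ is a sort in $\Gamma$ when each $x_f$ is declared in $\Gamma$ with sort $K_f(x_{pf})_{p\in K_f/\!/\mathcal{L}}$) from earlier variables; formulas built from $\bot,\top,\wedge,\vee,\to,\forall x:K,\exists x:K$; a sequent $\Gamma\mid\phi\Rightarrow\psi$ has $\phi,\psi$ formulas in context $\Gamma$. A context morphism $\alpha\colon\Gamma\Rightarrow\Delta$ with $\Delta=x_1:K_1,\dots,x_n:K_n$ is a list $(y_1,\dots,y_n)$ with $y_i$ declared in $\Gamma$ of sort $K_i[y_1/x_1,\dots,y_{i-1}/x_{i-1}]$; it acts on formulas by substitution.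 The deductive system $\mathcal{D}_{\mathrm{FOLDS}}$ (on well-formed sequents; "iff" means the rule applies in both directions): $\Gamma\mid\phi\Rightarrow\phi$; from $\Delta\mid\phi\Rightarrow\psi$ infer $\Gamma\mid\alpha(\phi)\Rightarrow\alpha(\psi)$ for a context morphism $\alpha\colon\Gamma\Rightarrow\Delta$; cut; from $\Gamma\mid\phi\Rightarrow\psi$ infer $\Gamma,x:K\mid\phi\Rightarrow\psi$; exchange of adjacent declarations $x:K,y:K'$ when $x$ does not occur in $K'$ and $y$ not in $K$; $\Gamma\mid\phi\Rightarrow\top$; $\Gamma\mid\bot\Rightarrow\phi$; $\Gamma\mid\exists x:K.\phi\Rightarrow\exists x:K.\top$; $\Gamma\mid\theta\Rightarrow\phi\wedge\psi$ iff $\Gamma\mid\theta\Rightarrow\phi$ and $\Gamma\mid\theta\Rightarrow\psi$; $\Gamma\mid\phi\vee\psi\Rightarrow\theta$ iff $\Gamma\mid\phi\Rightarrow\theta$ and $\Gamma\mid\psi\Rightarrow\theta$; $\Gamma\mid\theta\Rightarrow\phi\to\psi$ iff $\Gamma\mid\theta\wedge\phi\Rightarrow\psi$; $\Gamma\mid\theta\Rightarrow\forall x:K.\phi$ iff $\Gamma,x:K\mid\theta\Rightarrow\phi$; $\Gamma\mid\exists x:K.\phi\Rightarrow\theta$ iff $\Gamma,x:K\mid\phi\Rightarrow\theta$ (and, in the regular/coherent fragments, Frobenius $\Gamma\mid\phi\wedge\exists x:K.\psi\Rightarrow\exists x:K.(\phi\wedge\psi)$ for $x$ not free in $\phi$,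 and distributivity). $\mathcal{D}^{\mathrm{cl}}_{\mathrm{FOLDS}}$ adds $\Gamma\mid\top\Rightarrow\phi\vee(\phi\to\bot)$. A FOLDS $\mathcal{L}$-theory is a set of $\mathcal{L}$-sequents; $\mathbb{T}\vdash\tau$ (resp. $\vdash_{\mathrm{cl}}$) means $\tau$ is derivable in $\mathcal{D}_{\mathrm{FOLDS}}$ (resp. $\mathcal{D}^{\mathrm{cl}}_{\mathrm{FOLDS}}$) from finitely many sequents of $\mathbb{T}$. Semantics: MLTT is intensional Martin-Löf type theory with $\Pi,\Sigma,\mathbf{1},+,\mathbf{0}$ and a universe à la Tarski $\mathcal{U}$ (decoding $\mathrm{El}$); classical MLTT additionally assumes an inhabitant of the law of excluded middle. $\mathrm{Struc}(\mathcal{L}):=\Sigma(K_1:T_{K_1})\cdots(K_m:T_{K_m})$ over the objects $K_1<\dots<K_m$, with $T_K:=\Pi(f:\mathrm{El}(\mathrm{app}[K_f(pf)_{p\in K_f/\!/\mathcal{L}}]))_{f\in K/\!/\mathcal{L}}\ \mathcal{U}$ (variables named by arrows, equal composites naming the same variable; $\mathrm{app}[K'(\mathbf{q})]$ the iterated application; $T_K=\mathbf{1}\to\mathcal{U}$ if $K/\!/\mathcal{L}=\varnothing$). An $\mathcal{L}$-structure is a closed term $\mathcal{M}$ of $\mathrm{Struc}(\mathcal{L})$, with $K^{\mathcal{M}}$ its $K$-th projection. Sorts, contexts and formulas are interpreted by $K(\mathbf{x})^{\mathcal{M}}=\mathrm{El}(\mathrm{app}[K^{\mathcal{M}}(\mathbf{x})])$,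 $(\Gamma,x:K)^{\mathcal{M}}=\Gamma^{\mathcal{M}},x:K(\ldots)^{\mathcal{M}}$, $\bot\mapsto\mathbf{0}$, $\top\mapsto\mathbf{1}$, $\wedge\mapsto\times$, $\vee\mapsto+$, $\to\mapsto\to$, $\exists x:K\mapsto\Sigma(x:K^{\mathcal{M}})$, $\forall x:K\mapsto\Pi(x:K^{\mathcal{M}})$. $\mathcal{M}$ satisfies $\Gamma\mid\phi\Rightarrow\psi$ if the closed type $\Pi(\Gamma^{\mathcal{M}})\,\phi^{\mathcal{M}}\to\psi^{\mathcal{M}}$ has a derivable term. $\mathbb{T}\models\tau$ (resp. $\models_{\mathrm{cl}}$) means every $\mathcal{L}$-structure satisfying all sequents of $\mathbb{T}$ satisfies $\tau$, in MLTT (resp. classical MLTT). *)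

theory Defs
  imports Main
begin

text \<open>
  Variables are de Bruijn indices, both for FOLDS and for type theory; contexts are lists whose head
  is the most recent declaration, and each entry lives in the context formed by the entries behind
  it.  Formulas are thus identified up to renaming of bound variables, and ``\<open>x\<close> does not occur''
  becomes ``is a lifting''.
\<close>

section \<open>Signatures\<close>

definition increasing_listing :: "('x \<Rightarrow> 'x \<Rightarrow> bool) \<Rightarrow> 'x set \<Rightarrow> 'x list \<Rightarrow> bool" where
  "increasing_listing lt A xs \<longleftrightarrow>
     distinct xs \<and> set xs = A \<and> sorted_wrt (\<lambda>x y. \<not> lt y x) xs"

text \<open>
  A proper order is only a partial order, so a listing ``in increasing order'' need not be unique;
  \<open>arrows_from\<close> is an arbitrary such listing, for each object, of the non-identity arrows out of it.
  For a total order the listing is determined.  \<open>Comp L g f\<close> is \<open>g\<close> after \<open>f\<close>.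
\<close>

record ('o, 'a) signature =
  Obj :: "'o set"
  Arr :: "'a set"
  Dom :: "'a \<Rightarrow> 'o"
  Cod :: "'a \<Rightarrow> 'o"
  Id :: "'o \<Rightarrow> 'a"
  Comp :: "'a \<Rightarrow> 'a \<Rightarrow> 'a"
  obj_less :: "'o \<Rightarrow> 'o \<Rightarrow> bool"
  arr_less :: "'a \<Rightarrow> 'a \<Rightarrow> bool"
  arrows_from :: "'o \<Rightarrow> 'a list"

definition category :: "('o, 'a) signature \<Rightarrow> bool" where
  "category L \<longleftrightarrow>
     (\<forall>f\<in>Arr L. Dom L f \<in> Obj L \<and> Cod L f \<in> Obj L) \<and>
     (\<forall>K\<in>Obj L. Id L K \<in> Arr L \<and> Dom L (Id L K) = K \<and> Cod L (Id L K) = K) \<and>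
     (\<forall>f\<in>Arr L. \<forall>g\<in>Arr L. Dom L g = Cod L f \<longrightarrow>
        Comp L g f \<in> Arr L \<and> Dom L (Comp L g f) = Dom L f \<and> Cod L (Comp L g f) = Cod L g) \<and>
     (\<forall>f\<in>Arr L. Comp L f (Id L (Dom L f)) = f \<and> Comp L (Id L (Cod L f)) f = f) \<and>
     (\<forall>f\<in>Arr L. \<forall>g\<in>Arr L. \<forall>h\<in>Arr L. Dom L g = Cod L f \<longrightarrow> Dom L h = Cod L g \<longrightarrow>
        Comp L h (Comp L g f) = Comp L (Comp L h g) f)"

definition isomorphic :: "('o, 'a) signature \<Rightarrow> 'o \<Rightarrow> 'o \<Rightarrow> bool" where
  "isomorphic L K K' \<longleftrightarrow>
     (\<exists>f\<in>Arr L. \<exists>g\<in>Arr L. Dom L f = K \<and> Cod L f = K' \<and> Dom L g = K' \<and> Cod L g = K \<and>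
        Comp L g f = Id L K \<and> Comp L f g = Id L K')"

definition inverse_category :: "('o, 'a) signature \<Rightarrow> bool" where
  "inverse_category L \<longleftrightarrow>
     category L \<and>
     (\<forall>K\<in>Obj L. \<forall>K'\<in>Obj L. isomorphic L K K' \<longrightarrow> K = K') \<and>
     (\<forall>f\<in>Arr L. Dom L f = Cod L f \<longrightarrow> f = Id L (Dom L f)) \<and>
     (\<forall>K\<in>Obj L. finite {f \<in> Arr L. Dom L f = K})"

definition nonid_from :: "('o, 'a) signature \<Rightarrow> 'o \<Rightarrow> 'a set" where
  "nonid_from L K = {f \<in> Arr L. Dom L f = K \<and> f \<noteq> Id L K}"

definition proper_order :: "('o, 'a) signature \<Rightarrow> bool" where
  "proper_order L \<longleftrightarrow>
     irreflp_on (Obj L) (obj_less L) \<and> transp_on (Obj L) (obj_less L) \<and>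
     irreflp_on (Arr L) (arr_less L) \<and> transp_on (Arr L) (arr_less L) \<and>
     (\<forall>K\<in>Obj L. \<forall>f\<in>nonid_from L K. obj_less L (Cod L f) K) \<and>
     (\<forall>f\<in>Arr L. \<forall>g\<in>Arr L. obj_less L (Cod L f) (Cod L g) \<longrightarrow> arr_less L f g)"

definition folds_signature :: "('o, 'a) signature \<Rightarrow> bool" where
  "folds_signature L \<longleftrightarrow>
     inverse_category L \<and> proper_order L \<and>
     (\<forall>K\<in>Obj L. increasing_listing (arr_less L) (nonid_from L K) (arrows_from L K))"

definition finite_signature :: "('o, 'a) signature \<Rightarrow> bool" where
  "finite_signature L \<longleftrightarrow> finite (Obj L) \<and> finite (Arr L)"

lemma increasing_listing_exists:
  assumes "finite A" "irreflp_on A lt" "transp_on A lt"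
  shows "\<exists>xs. increasing_listing lt A xs"
  using assms
proof (induction "card A" arbitrary: A)
  case 0
  then show ?case by (auto simp: increasing_listing_def)
next
  case (Suc n)
  have "asymp_on A lt"
  proof (rule asymp_onI)
    show "\<not> lt y x" if "x \<in> A" "y \<in> A" "lt x y" for x y
      using that irreflp_onD[OF Suc.prems(2), of x] transp_onD[OF Suc.prems(3), of x y x] by blast
  qed
  moreover have "A \<noteq> {}"
    using Suc.hyps(2) by auto
  ultimately obtain m where m: "m \<in> A" "\<forall>x\<in>A. x \<noteq> m \<longrightarrow> \<not> lt x m"
    using Finite_Set.bex_min_element[OF Suc.prems(1) _ Suc.prems(3)] by meson
  have "n = card (A - {m})"
    using Suc.hyps(2) Suc.prems(1) m(1) by simp
  moreover have "irreflp_on (A - {m}) lt" "transp_on (A - {m}) lt"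
    using Suc.prems by (auto intro: irreflp_on_subset transp_on_subset)
  ultimately obtain xs where "increasing_listing lt (A - {m}) xs"
    using Suc.hyps(1) Suc.prems(1) by blast
  then have "increasing_listing lt A (m # xs)"
    using m by (auto simp: increasing_listing_def)
  then show ?case ..
qed

primrec pos :: "'x \<Rightarrow> 'x list \<Rightarrow> nat" where
  "pos x [] = 0"
| "pos x (y # ys) = (if x = y then 0 else Suc (pos x ys))"

definition up :: "(nat \<Rightarrow> nat) \<Rightarrow> nat \<Rightarrow> nat" where
  "up \<rho> = case_nat 0 (\<lambda>n. Suc (\<rho> n))"

section \<open>Syntax of FOLDS\<close>

text \<open>\<open>Sort K xs\<close> lists the variables \<open>x_f\<close> in the order of \<open>arrows_from L K\<close>.\<close>

datatype 'o sort = Sort 'o "nat list"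

datatype 'o form =
    Bot
  | Top
  | And "'o form" "'o form"
  | Or "'o form" "'o form"
  | Imp "'o form" "'o form"
  | Forall "'o sort" "'o form"
  | Exists "'o sort" "'o form"

datatype 'o sequent = Sequent "'o sort list" "'o form" "'o form"

primrec ren_sort :: "(nat \<Rightarrow> nat) \<Rightarrow> 'o sort \<Rightarrow> 'o sort" where
  "ren_sort \<rho> (Sort K xs) = Sort K (map \<rho> xs)"

primrec ren_form :: "(nat \<Rightarrow> nat) \<Rightarrow> 'o form \<Rightarrow> 'o form" where
  "ren_form \<rho> Bot = Bot"
| "ren_form \<rho> Top = Top"
| "ren_form \<rho> (And \<phi> \<psi>) = And (ren_form \<rho> \<phi>) (ren_form \<rho> \<psi>)"
| "ren_form \<rho> (Or \<phi> \<psi>) = Or (ren_form \<rho> \<phi>) (ren_form \<rho> \<psi>)"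
| "ren_form \<rho> (Imp \<phi> \<psi>) = Imp (ren_form \<rho> \<phi>) (ren_form \<rho> \<psi>)"
| "ren_form \<rho> (Forall K \<phi>) = Forall (ren_sort \<rho> K) (ren_form (up \<rho>) \<phi>)"
| "ren_form \<rho> (Exists K \<phi>) = Exists (ren_sort \<rho> K) (ren_form (up \<rho>) \<phi>)"

definition declared :: "'o sort list \<Rightarrow> nat \<Rightarrow> 'o sort \<Rightarrow> bool" where
  "declared \<Gamma> i S \<longleftrightarrow> i < length \<Gamma> \<and> S = ren_sort (\<lambda>n. n + Suc i) (\<Gamma> ! i)"

text \<open>The sort \<open>K_f(x_{pf})_p\<close> that the argument \<open>x_f\<close> of \<open>K(x_f)_f\<close> has to have.\<close>

definition arg_sort :: "('o, 'a) signature \<Rightarrow> 'o \<Rightarrow> nat list \<Rightarrow> 'a \<Rightarrow> 'o sort" where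
  "arg_sort L K xs f =
     Sort (Cod L f) (map (\<lambda>p. xs ! pos (Comp L p f) (arrows_from L K)) (arrows_from L (Cod L f)))"

fun sort_in :: "('o, 'a) signature \<Rightarrow> 'o sort list \<Rightarrow> 'o sort \<Rightarrow> bool" where
  "sort_in L \<Gamma> (Sort K xs) \<longleftrightarrow>
     K \<in> Obj L \<and> length xs = length (arrows_from L K) \<and>
     (\<forall>f\<in>nonid_from L K. declared \<Gamma> (xs ! pos f (arrows_from L K)) (arg_sort L K xs f))"

primrec wf_context :: "('o, 'a) signature \<Rightarrow> 'o sort list \<Rightarrow> bool" where
  "wf_context L [] \<longleftrightarrow> True"
| "wf_context L (K # \<Gamma>) \<longleftrightarrow> wf_context L \<Gamma> \<and> sort_in L \<Gamma> K"

primrec form_in :: "('o, 'a) signature \<Rightarrow> 'o sort list \<Rightarrow> 'o form \<Rightarrow> bool" where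
  "form_in L \<Gamma> Bot \<longleftrightarrow> True"
| "form_in L \<Gamma> Top \<longleftrightarrow> True"
| "form_in L \<Gamma> (And \<phi> \<psi>) \<longleftrightarrow> form_in L \<Gamma> \<phi> \<and> form_in L \<Gamma> \<psi>"
| "form_in L \<Gamma> (Or \<phi> \<psi>) \<longleftrightarrow> form_in L \<Gamma> \<phi> \<and> form_in L \<Gamma> \<psi>"
| "form_in L \<Gamma> (Imp \<phi> \<psi>) \<longleftrightarrow> form_in L \<Gamma> \<phi> \<and> form_in L \<Gamma> \<psi>"
| "form_in L \<Gamma> (Forall K \<phi>) \<longleftrightarrow> sort_in L \<Gamma> K \<and> form_in L (K # \<Gamma>) \<phi>"
| "form_in L \<Gamma> (Exists K \<phi>) \<longleftrightarrow> sort_in L \<Gamma> K \<and> form_in L (K # \<Gamma>) \<phi>"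

primrec wf_sequent :: "('o, 'a) signature \<Rightarrow> 'o sequent \<Rightarrow> bool" where
  "wf_sequent L (Sequent \<Gamma> \<phi> \<psi>) \<longleftrightarrow> wf_context L \<Gamma> \<and> form_in L \<Gamma> \<phi> \<and> form_in L \<Gamma> \<psi>"

text \<open>\<open>ys ! i\<close> is the variable substituted for variable \<open>i\<close> of \<open>\<Delta>\<close>; the sort \<open>\<Delta> ! i\<close> mentions only
  the variables of \<open>\<Delta>\<close> declared before it, which are those with index \<open>j + Suc i\<close>.\<close>

definition context_morphism :: "'o sort list \<Rightarrow> 'o sort list \<Rightarrow> nat list \<Rightarrow> bool" where
  "context_morphism \<Gamma> \<Delta> ys \<longleftrightarrow>
     length ys = length \<Delta> \<and>
     (\<forall>i<length \<Delta>. declared \<Gamma> (ys ! i) (ren_sort (\<lambda>j. ys ! (j + Suc i)) (\<Delta> ! i)))"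

section \<open>The deductive systems\<close>

datatype logic = Intuitionistic | Classical

definition swap :: "nat \<Rightarrow> nat \<Rightarrow> nat" where
  "swap n = id(n := Suc n, Suc n := n)"

text \<open>The effect on the later declarations \<open>\<Delta>\<close> of exchanging the two declarations just before them.\<close>

primrec swap_context :: "'o sort list \<Rightarrow> 'o sort list" where
  "swap_context [] = []"
| "swap_context (K # \<Delta>) = ren_sort (swap (length \<Delta>)) K # swap_context \<Delta>"

abbreviation lift_sort :: "'o sort \<Rightarrow> 'o sort" where
  "lift_sort \<equiv> ren_sort Suc"

abbreviation lift_form :: "'o form \<Rightarrow> 'o form" where
  "lift_form \<equiv> ren_form Suc"

text \<open>
  Every rule demands that its conclusion be a well-formed sequent.  The rules \<open>frobenius\<close> and
  \<open>distributivity\<close>, needed in fragments without \<open>\<rightarrow>\<close>, are derivable from the others here.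
\<close>

inductive deriv :: "logic \<Rightarrow> ('o, 'a) signature \<Rightarrow> 'o sequent set \<Rightarrow> 'o sequent \<Rightarrow> bool"
  for lg :: logic and L :: "('o, 'a) signature" and S :: "'o sequent set" where
  axm: "\<sigma> \<in> S \<Longrightarrow> wf_sequent L \<sigma> \<Longrightarrow> deriv lg L S \<sigma>"
| identity: "wf_sequent L (Sequent \<Gamma> \<phi> \<phi>) \<Longrightarrow> deriv lg L S (Sequent \<Gamma> \<phi> \<phi>)"
| substitution: "deriv lg L S (Sequent \<Delta> \<phi> \<psi>) \<Longrightarrow> context_morphism \<Gamma> \<Delta> ys \<Longrightarrow>
    wf_sequent L (Sequent \<Gamma> (ren_form (\<lambda>i. ys ! i) \<phi>) (ren_form (\<lambda>i. ys ! i) \<psi>)) \<Longrightarrow>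
    deriv lg L S (Sequent \<Gamma> (ren_form (\<lambda>i. ys ! i) \<phi>) (ren_form (\<lambda>i. ys ! i) \<psi>))"
| cut: "deriv lg L S (Sequent \<Gamma> \<phi> \<psi>) \<Longrightarrow> deriv lg L S (Sequent \<Gamma> \<psi> \<theta>) \<Longrightarrow>
    wf_sequent L (Sequent \<Gamma> \<phi> \<theta>) \<Longrightarrow> deriv lg L S (Sequent \<Gamma> \<phi> \<theta>)"
| weakening: "deriv lg L S (Sequent \<Gamma> \<phi> \<psi>) \<Longrightarrow>
    wf_sequent L (Sequent (K # \<Gamma>) (lift_form \<phi>) (lift_form \<psi>)) \<Longrightarrow>
    deriv lg L S (Sequent (K # \<Gamma>) (lift_form \<phi>) (lift_form \<psi>))"
| exchange: "deriv lg L S (Sequent (\<Delta> @ lift_sort K' # K # \<Gamma>) \<phi> \<psi>) \<Longrightarrow>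
    wf_sequent L (Sequent (swap_context \<Delta> @ lift_sort K # K' # \<Gamma>)
      (ren_form (swap (length \<Delta>)) \<phi>) (ren_form (swap (length \<Delta>)) \<psi>)) \<Longrightarrow>
    deriv lg L S (Sequent (swap_context \<Delta> @ lift_sort K # K' # \<Gamma>)
      (ren_form (swap (length \<Delta>)) \<phi>) (ren_form (swap (length \<Delta>)) \<psi>))"
| top: "wf_sequent L (Sequent \<Gamma> \<phi> Top) \<Longrightarrow> deriv lg L S (Sequent \<Gamma> \<phi> Top)"
| bot: "wf_sequent L (Sequent \<Gamma> Bot \<phi>) \<Longrightarrow> deriv lg L S (Sequent \<Gamma> Bot \<phi>)"
| ex_top: "wf_sequent L (Sequent \<Gamma> (Exists K \<phi>) (Exists K Top)) \<Longrightarrow>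
    deriv lg L S (Sequent \<Gamma> (Exists K \<phi>) (Exists K Top))"
| and_intro: "deriv lg L S (Sequent \<Gamma> \<theta> \<phi>) \<Longrightarrow> deriv lg L S (Sequent \<Gamma> \<theta> \<psi>) \<Longrightarrow>
    wf_sequent L (Sequent \<Gamma> \<theta> (And \<phi> \<psi>)) \<Longrightarrow> deriv lg L S (Sequent \<Gamma> \<theta> (And \<phi> \<psi>))"
| and_left: "deriv lg L S (Sequent \<Gamma> \<theta> (And \<phi> \<psi>)) \<Longrightarrow>
    wf_sequent L (Sequent \<Gamma> \<theta> \<phi>) \<Longrightarrow> deriv lg L S (Sequent \<Gamma> \<theta> \<phi>)"
| and_right: "deriv lg L S (Sequent \<Gamma> \<theta> (And \<phi> \<psi>)) \<Longrightarrow>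
    wf_sequent L (Sequent \<Gamma> \<theta> \<psi>) \<Longrightarrow> deriv lg L S (Sequent \<Gamma> \<theta> \<psi>)"
| or_elim: "deriv lg L S (Sequent \<Gamma> \<phi> \<theta>) \<Longrightarrow> deriv lg L S (Sequent \<Gamma> \<psi> \<theta>) \<Longrightarrow>
    wf_sequent L (Sequent \<Gamma> (Or \<phi> \<psi>) \<theta>) \<Longrightarrow> deriv lg L S (Sequent \<Gamma> (Or \<phi> \<psi>) \<theta>)"
| or_left: "deriv lg L S (Sequent \<Gamma> (Or \<phi> \<psi>) \<theta>) \<Longrightarrow>
    wf_sequent L (Sequent \<Gamma> \<phi> \<theta>) \<Longrightarrow> deriv lg L S (Sequent \<Gamma> \<phi> \<theta>)"
| or_right: "deriv lg L S (Sequent \<Gamma> (Or \<phi> \<psi>) \<theta>) \<Longrightarrow>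
    wf_sequent L (Sequent \<Gamma> \<psi> \<theta>) \<Longrightarrow> deriv lg L S (Sequent \<Gamma> \<psi> \<theta>)"
| imp_intro: "deriv lg L S (Sequent \<Gamma> (And \<theta> \<phi>) \<psi>) \<Longrightarrow>
    wf_sequent L (Sequent \<Gamma> \<theta> (Imp \<phi> \<psi>)) \<Longrightarrow> deriv lg L S (Sequent \<Gamma> \<theta> (Imp \<phi> \<psi>))"
| imp_elim: "deriv lg L S (Sequent \<Gamma> \<theta> (Imp \<phi> \<psi>)) \<Longrightarrow>
    wf_sequent L (Sequent \<Gamma> (And \<theta> \<phi>) \<psi>) \<Longrightarrow> deriv lg L S (Sequent \<Gamma> (And \<theta> \<phi>) \<psi>)"
| all_intro: "deriv lg L S (Sequent (K # \<Gamma>) (lift_form \<theta>) \<phi>) \<Longrightarrow>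
    wf_sequent L (Sequent \<Gamma> \<theta> (Forall K \<phi>)) \<Longrightarrow> deriv lg L S (Sequent \<Gamma> \<theta> (Forall K \<phi>))"
| all_elim: "deriv lg L S (Sequent \<Gamma> \<theta> (Forall K \<phi>)) \<Longrightarrow>
    wf_sequent L (Sequent (K # \<Gamma>) (lift_form \<theta>) \<phi>) \<Longrightarrow>
    deriv lg L S (Sequent (K # \<Gamma>) (lift_form \<theta>) \<phi>)"
| ex_elim: "deriv lg L S (Sequent (K # \<Gamma>) \<phi> (lift_form \<theta>)) \<Longrightarrow>
    wf_sequent L (Sequent \<Gamma> (Exists K \<phi>) \<theta>) \<Longrightarrow> deriv lg L S (Sequent \<Gamma> (Exists K \<phi>) \<theta>)"
| ex_intro: "deriv lg L S (Sequent \<Gamma> (Exists K \<phi>) \<theta>) \<Longrightarrow>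
    wf_sequent L (Sequent (K # \<Gamma>) \<phi> (lift_form \<theta>)) \<Longrightarrow>
    deriv lg L S (Sequent (K # \<Gamma>) \<phi> (lift_form \<theta>))"
| frobenius: "wf_sequent L (Sequent \<Gamma> (And \<phi> (Exists K \<psi>)) (Exists K (And (lift_form \<phi>) \<psi>))) \<Longrightarrow>
    deriv lg L S (Sequent \<Gamma> (And \<phi> (Exists K \<psi>)) (Exists K (And (lift_form \<phi>) \<psi>)))"
| distributivity: "wf_sequent L (Sequent \<Gamma> (And \<phi> (Or \<psi> \<theta>)) (Or (And \<phi> \<psi>) (And \<phi> \<theta>))) \<Longrightarrow>
    deriv lg L S (Sequent \<Gamma> (And \<phi> (Or \<psi> \<theta>)) (Or (And \<phi> \<psi>) (And \<phi> \<theta>)))"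
| excluded_middle: "lg = Classical \<Longrightarrow> wf_sequent L (Sequent \<Gamma> Top (Or \<phi> (Imp \<phi> Bot))) \<Longrightarrow>
    deriv lg L S (Sequent \<Gamma> Top (Or \<phi> (Imp \<phi> Bot)))"

definition derives :: "logic \<Rightarrow> ('o, 'a) signature \<Rightarrow> 'o sequent set \<Rightarrow> 'o sequent \<Rightarrow> bool" where
  "derives lg L T \<tau> \<longleftrightarrow> (\<exists>S. finite S \<and> S \<subseteq> T \<and> deriv lg L S \<tau>)"

section \<open>Type theory\<close>

text \<open>
  Terms carry no type annotations, as in Martin-Loef's own presentation.  The universe is closed
  under all the type formers.  \<open>Lem\<close> is the constant of classical type theory.
  \<open>Lam\<close>, the two branches of \<open>Case\<close>, and the last arguments of \<open>CPi\<close>, \<open>CSig\<close>, \<open>PiT\<close>, \<open>SigT\<close> bind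
  one variable.
\<close>

datatype tm =
    Var nat
  | Lam tm
  | App tm tm
  | Pr tm tm
  | Fst tm
  | Snd tm
  | Star
  | UnitElim tm tm
  | InL tm
  | InR tm
  | Case tm tm tm
  | Abort tm
  | CPi tm tm
  | CSig tm tm
  | CUnit
  | CSum tm tm
  | CEmpty
  | Lem

datatype ty =
    Univ
  | El tm
  | PiT ty ty
  | SigT ty ty
  | UnitT
  | SumT ty ty
  | EmptyT

primrec ren_tm :: "(nat \<Rightarrow> nat) \<Rightarrow> tm \<Rightarrow> tm" where
  "ren_tm \<rho> (Var i) = Var (\<rho> i)"
| "ren_tm \<rho> (Lam t) = Lam (ren_tm (up \<rho>) t)"
| "ren_tm \<rho> (App t u) = App (ren_tm \<rho> t) (ren_tm \<rho> u)"
| "ren_tm \<rho> (Pr t u) = Pr (ren_tm \<rho> t) (ren_tm \<rho> u)"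
| "ren_tm \<rho> (Fst t) = Fst (ren_tm \<rho> t)"
| "ren_tm \<rho> (Snd t) = Snd (ren_tm \<rho> t)"
| "ren_tm \<rho> Star = Star"
| "ren_tm \<rho> (UnitElim t c) = UnitElim (ren_tm \<rho> t) (ren_tm \<rho> c)"
| "ren_tm \<rho> (InL t) = InL (ren_tm \<rho> t)"
| "ren_tm \<rho> (InR t) = InR (ren_tm \<rho> t)"
| "ren_tm \<rho> (Case t d e) = Case (ren_tm \<rho> t) (ren_tm (up \<rho>) d) (ren_tm (up \<rho>) e)"
| "ren_tm \<rho> (Abort t) = Abort (ren_tm \<rho> t)"
| "ren_tm \<rho> (CPi a b) = CPi (ren_tm \<rho> a) (ren_tm (up \<rho>) b)"
| "ren_tm \<rho> (CSig a b) = CSig (ren_tm \<rho> a) (ren_tm (up \<rho>) b)"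
| "ren_tm \<rho> CUnit = CUnit"
| "ren_tm \<rho> (CSum a b) = CSum (ren_tm \<rho> a) (ren_tm \<rho> b)"
| "ren_tm \<rho> CEmpty = CEmpty"
| "ren_tm \<rho> Lem = Lem"

definition ups :: "(nat \<Rightarrow> tm) \<Rightarrow> nat \<Rightarrow> tm" where
  "ups \<sigma> = case_nat (Var 0) (\<lambda>n. ren_tm Suc (\<sigma> n))"

primrec sub_tm :: "(nat \<Rightarrow> tm) \<Rightarrow> tm \<Rightarrow> tm" where
  "sub_tm \<sigma> (Var i) = \<sigma> i"
| "sub_tm \<sigma> (Lam t) = Lam (sub_tm (ups \<sigma>) t)"
| "sub_tm \<sigma> (App t u) = App (sub_tm \<sigma> t) (sub_tm \<sigma> u)"
| "sub_tm \<sigma> (Pr t u) = Pr (sub_tm \<sigma> t) (sub_tm \<sigma> u)"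
| "sub_tm \<sigma> (Fst t) = Fst (sub_tm \<sigma> t)"
| "sub_tm \<sigma> (Snd t) = Snd (sub_tm \<sigma> t)"
| "sub_tm \<sigma> Star = Star"
| "sub_tm \<sigma> (UnitElim t c) = UnitElim (sub_tm \<sigma> t) (sub_tm \<sigma> c)"
| "sub_tm \<sigma> (InL t) = InL (sub_tm \<sigma> t)"
| "sub_tm \<sigma> (InR t) = InR (sub_tm \<sigma> t)"
| "sub_tm \<sigma> (Case t d e) = Case (sub_tm \<sigma> t) (sub_tm (ups \<sigma>) d) (sub_tm (ups \<sigma>) e)"
| "sub_tm \<sigma> (Abort t) = Abort (sub_tm \<sigma> t)"
| "sub_tm \<sigma> (CPi a b) = CPi (sub_tm \<sigma> a) (sub_tm (ups \<sigma>) b)"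
| "sub_tm \<sigma> (CSig a b) = CSig (sub_tm \<sigma> a) (sub_tm (ups \<sigma>) b)"
| "sub_tm \<sigma> CUnit = CUnit"
| "sub_tm \<sigma> (CSum a b) = CSum (sub_tm \<sigma> a) (sub_tm \<sigma> b)"
| "sub_tm \<sigma> CEmpty = CEmpty"
| "sub_tm \<sigma> Lem = Lem"

primrec ren_ty :: "(nat \<Rightarrow> nat) \<Rightarrow> ty \<Rightarrow> ty" where
  "ren_ty \<rho> Univ = Univ"
| "ren_ty \<rho> (El t) = El (ren_tm \<rho> t)"
| "ren_ty \<rho> (PiT A B) = PiT (ren_ty \<rho> A) (ren_ty (up \<rho>) B)"
| "ren_ty \<rho> (SigT A B) = SigT (ren_ty \<rho> A) (ren_ty (up \<rho>) B)"
| "ren_ty \<rho> UnitT = UnitT"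
| "ren_ty \<rho> (SumT A B) = SumT (ren_ty \<rho> A) (ren_ty \<rho> B)"
| "ren_ty \<rho> EmptyT = EmptyT"

primrec sub_ty :: "(nat \<Rightarrow> tm) \<Rightarrow> ty \<Rightarrow> ty" where
  "sub_ty \<sigma> Univ = Univ"
| "sub_ty \<sigma> (El t) = El (sub_tm \<sigma> t)"
| "sub_ty \<sigma> (PiT A B) = PiT (sub_ty \<sigma> A) (sub_ty (ups \<sigma>) B)"
| "sub_ty \<sigma> (SigT A B) = SigT (sub_ty \<sigma> A) (sub_ty (ups \<sigma>) B)"
| "sub_ty \<sigma> UnitT = UnitT"
| "sub_ty \<sigma> (SumT A B) = SumT (sub_ty \<sigma> A) (sub_ty \<sigma> B)"
| "sub_ty \<sigma> EmptyT = EmptyT"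

abbreviation lift_tm :: "tm \<Rightarrow> tm" where
  "lift_tm \<equiv> ren_tm Suc"

abbreviation lift_ty :: "ty \<Rightarrow> ty" where
  "lift_ty \<equiv> ren_ty Suc"

definition inst_tm :: "tm \<Rightarrow> tm \<Rightarrow> tm" where
  "inst_tm t a = sub_tm (case_nat a Var) t"

definition inst_ty :: "ty \<Rightarrow> tm \<Rightarrow> ty" where
  "inst_ty B a = sub_ty (case_nat a Var) B"

text \<open>\<open>reinst_ty C c\<close> replaces the last variable of \<open>C\<close> by a term \<open>c\<close> that itself lives in a context
  with one (other) variable in its place.\<close>

definition reinst_ty :: "ty \<Rightarrow> tm \<Rightarrow> ty" where
  "reinst_ty C c = sub_ty (case_nat c (\<lambda>n. Var (Suc n))) C"

definition fun_ty :: "ty \<Rightarrow> ty \<Rightarrow> ty" where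
  "fun_ty A B = PiT A (lift_ty B)"

definition prod_ty :: "ty \<Rightarrow> ty \<Rightarrow> ty" where
  "prod_ty A B = SigT A (lift_ty B)"

definition lem_ty :: ty where
  "lem_ty = PiT Univ (SumT (El (Var 0)) (fun_ty (El (Var 0)) EmptyT))"

inductive is_ctx :: "logic \<Rightarrow> ty list \<Rightarrow> bool"
  and is_ty :: "logic \<Rightarrow> ty list \<Rightarrow> ty \<Rightarrow> bool"
  and eq_ty :: "logic \<Rightarrow> ty list \<Rightarrow> ty \<Rightarrow> ty \<Rightarrow> bool"
  and has_ty :: "logic \<Rightarrow> ty list \<Rightarrow> tm \<Rightarrow> ty \<Rightarrow> bool"
  and eq_tm :: "logic \<Rightarrow> ty list \<Rightarrow> tm \<Rightarrow> tm \<Rightarrow> ty \<Rightarrow> bool"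
  for lg :: logic where
  ctx_nil: "is_ctx lg []"
| ctx_cons: "is_ctx lg \<Gamma> \<Longrightarrow> is_ty lg \<Gamma> A \<Longrightarrow> is_ctx lg (A # \<Gamma>)"

| ty_univ: "is_ctx lg \<Gamma> \<Longrightarrow> is_ty lg \<Gamma> Univ"
| ty_el: "has_ty lg \<Gamma> a Univ \<Longrightarrow> is_ty lg \<Gamma> (El a)"
| ty_pi: "is_ty lg \<Gamma> A \<Longrightarrow> is_ty lg (A # \<Gamma>) B \<Longrightarrow> is_ty lg \<Gamma> (PiT A B)"
| ty_sig: "is_ty lg \<Gamma> A \<Longrightarrow> is_ty lg (A # \<Gamma>) B \<Longrightarrow> is_ty lg \<Gamma> (SigT A B)"
| ty_unit: "is_ctx lg \<Gamma> \<Longrightarrow> is_ty lg \<Gamma> UnitT"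
| ty_sum: "is_ty lg \<Gamma> A \<Longrightarrow> is_ty lg \<Gamma> B \<Longrightarrow> is_ty lg \<Gamma> (SumT A B)"
| ty_empty: "is_ctx lg \<Gamma> \<Longrightarrow> is_ty lg \<Gamma> EmptyT"

| eqty_refl: "is_ty lg \<Gamma> A \<Longrightarrow> eq_ty lg \<Gamma> A A"
| eqty_sym: "eq_ty lg \<Gamma> A B \<Longrightarrow> eq_ty lg \<Gamma> B A"
| eqty_trans: "eq_ty lg \<Gamma> A B \<Longrightarrow> eq_ty lg \<Gamma> B C \<Longrightarrow> eq_ty lg \<Gamma> A C"
| eqty_el: "eq_tm lg \<Gamma> a b Univ \<Longrightarrow> eq_ty lg \<Gamma> (El a) (El b)"
| eqty_pi: "is_ty lg \<Gamma> A \<Longrightarrow> eq_ty lg \<Gamma> A A' \<Longrightarrow> eq_ty lg (A # \<Gamma>) B B' \<Longrightarrow>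
    eq_ty lg \<Gamma> (PiT A B) (PiT A' B')"
| eqty_sig: "is_ty lg \<Gamma> A \<Longrightarrow> eq_ty lg \<Gamma> A A' \<Longrightarrow> eq_ty lg (A # \<Gamma>) B B' \<Longrightarrow>
    eq_ty lg \<Gamma> (SigT A B) (SigT A' B')"
| eqty_sum: "eq_ty lg \<Gamma> A A' \<Longrightarrow> eq_ty lg \<Gamma> B B' \<Longrightarrow> eq_ty lg \<Gamma> (SumT A B) (SumT A' B')"
| el_pi: "has_ty lg \<Gamma> a Univ \<Longrightarrow> has_ty lg (El a # \<Gamma>) b Univ \<Longrightarrow>
    eq_ty lg \<Gamma> (El (CPi a b)) (PiT (El a) (El b))"
| el_sig: "has_ty lg \<Gamma> a Univ \<Longrightarrow> has_ty lg (El a # \<Gamma>) b Univ \<Longrightarrow>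
    eq_ty lg \<Gamma> (El (CSig a b)) (SigT (El a) (El b))"
| el_unit: "is_ctx lg \<Gamma> \<Longrightarrow> eq_ty lg \<Gamma> (El CUnit) UnitT"
| el_sum: "has_ty lg \<Gamma> a Univ \<Longrightarrow> has_ty lg \<Gamma> b Univ \<Longrightarrow>
    eq_ty lg \<Gamma> (El (CSum a b)) (SumT (El a) (El b))"
| el_empty: "is_ctx lg \<Gamma> \<Longrightarrow> eq_ty lg \<Gamma> (El CEmpty) EmptyT"

| tm_conv: "has_ty lg \<Gamma> t A \<Longrightarrow> eq_ty lg \<Gamma> A B \<Longrightarrow> has_ty lg \<Gamma> t B"
| tm_var: "is_ctx lg \<Gamma> \<Longrightarrow> i < length \<Gamma> \<Longrightarrow>
    has_ty lg \<Gamma> (Var i) (ren_ty (\<lambda>n. n + Suc i) (\<Gamma> ! i))"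
| tm_lam: "is_ty lg \<Gamma> A \<Longrightarrow> has_ty lg (A # \<Gamma>) t B \<Longrightarrow> has_ty lg \<Gamma> (Lam t) (PiT A B)"
| tm_app: "has_ty lg \<Gamma> t (PiT A B) \<Longrightarrow> has_ty lg \<Gamma> a A \<Longrightarrow>
    has_ty lg \<Gamma> (App t a) (inst_ty B a)"
| tm_pair: "is_ty lg \<Gamma> A \<Longrightarrow> is_ty lg (A # \<Gamma>) B \<Longrightarrow> has_ty lg \<Gamma> a A \<Longrightarrow>
    has_ty lg \<Gamma> b (inst_ty B a) \<Longrightarrow> has_ty lg \<Gamma> (Pr a b) (SigT A B)"
| tm_fst: "has_ty lg \<Gamma> p (SigT A B) \<Longrightarrow> has_ty lg \<Gamma> (Fst p) A"
| tm_snd: "has_ty lg \<Gamma> p (SigT A B) \<Longrightarrow> has_ty lg \<Gamma> (Snd p) (inst_ty B (Fst p))"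
| tm_star: "is_ctx lg \<Gamma> \<Longrightarrow> has_ty lg \<Gamma> Star UnitT"
| tm_unit_elim: "is_ty lg (UnitT # \<Gamma>) C \<Longrightarrow> has_ty lg \<Gamma> t UnitT \<Longrightarrow>
    has_ty lg \<Gamma> c (inst_ty C Star) \<Longrightarrow> has_ty lg \<Gamma> (UnitElim t c) (inst_ty C t)"
| tm_inl: "is_ty lg \<Gamma> A \<Longrightarrow> is_ty lg \<Gamma> B \<Longrightarrow> has_ty lg \<Gamma> a A \<Longrightarrow> has_ty lg \<Gamma> (InL a) (SumT A B)"
| tm_inr: "is_ty lg \<Gamma> A \<Longrightarrow> is_ty lg \<Gamma> B \<Longrightarrow> has_ty lg \<Gamma> b B \<Longrightarrow> has_ty lg \<Gamma> (InR b) (SumT A B)"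
| tm_case: "is_ty lg \<Gamma> A \<Longrightarrow> is_ty lg \<Gamma> B \<Longrightarrow> is_ty lg (SumT A B # \<Gamma>) C \<Longrightarrow>
    has_ty lg \<Gamma> t (SumT A B) \<Longrightarrow>
    has_ty lg (A # \<Gamma>) d (reinst_ty C (InL (Var 0))) \<Longrightarrow>
    has_ty lg (B # \<Gamma>) e (reinst_ty C (InR (Var 0))) \<Longrightarrow>
    has_ty lg \<Gamma> (Case t d e) (inst_ty C t)"
| tm_abort: "is_ty lg (EmptyT # \<Gamma>) C \<Longrightarrow> has_ty lg \<Gamma> t EmptyT \<Longrightarrow>
    has_ty lg \<Gamma> (Abort t) (inst_ty C t)"
| tm_cpi: "has_ty lg \<Gamma> a Univ \<Longrightarrow> has_ty lg (El a # \<Gamma>) b Univ \<Longrightarrow> has_ty lg \<Gamma> (CPi a b) Univ"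
| tm_csig: "has_ty lg \<Gamma> a Univ \<Longrightarrow> has_ty lg (El a # \<Gamma>) b Univ \<Longrightarrow> has_ty lg \<Gamma> (CSig a b) Univ"
| tm_cunit: "is_ctx lg \<Gamma> \<Longrightarrow> has_ty lg \<Gamma> CUnit Univ"
| tm_csum: "has_ty lg \<Gamma> a Univ \<Longrightarrow> has_ty lg \<Gamma> b Univ \<Longrightarrow> has_ty lg \<Gamma> (CSum a b) Univ"
| tm_cempty: "is_ctx lg \<Gamma> \<Longrightarrow> has_ty lg \<Gamma> CEmpty Univ"
| tm_lem: "lg = Classical \<Longrightarrow> is_ctx lg \<Gamma> \<Longrightarrow> has_ty lg \<Gamma> Lem lem_ty"

| eq_refl: "has_ty lg \<Gamma> t A \<Longrightarrow> eq_tm lg \<Gamma> t t A"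
| eq_sym: "eq_tm lg \<Gamma> t u A \<Longrightarrow> eq_tm lg \<Gamma> u t A"
| eq_trans: "eq_tm lg \<Gamma> t u A \<Longrightarrow> eq_tm lg \<Gamma> u v A \<Longrightarrow> eq_tm lg \<Gamma> t v A"
| eq_conv: "eq_tm lg \<Gamma> t u A \<Longrightarrow> eq_ty lg \<Gamma> A B \<Longrightarrow> eq_tm lg \<Gamma> t u B"
| eq_lam: "is_ty lg \<Gamma> A \<Longrightarrow> eq_tm lg (A # \<Gamma>) t t' B \<Longrightarrow> eq_tm lg \<Gamma> (Lam t) (Lam t') (PiT A B)"
| eq_app: "eq_tm lg \<Gamma> t t' (PiT A B) \<Longrightarrow> eq_tm lg \<Gamma> a a' A \<Longrightarrow>
    eq_tm lg \<Gamma> (App t a) (App t' a') (inst_ty B a)"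
| eq_pair: "is_ty lg \<Gamma> A \<Longrightarrow> is_ty lg (A # \<Gamma>) B \<Longrightarrow> eq_tm lg \<Gamma> a a' A \<Longrightarrow>
    eq_tm lg \<Gamma> b b' (inst_ty B a) \<Longrightarrow> eq_tm lg \<Gamma> (Pr a b) (Pr a' b') (SigT A B)"
| eq_fst: "eq_tm lg \<Gamma> p p' (SigT A B) \<Longrightarrow> eq_tm lg \<Gamma> (Fst p) (Fst p') A"
| eq_snd: "eq_tm lg \<Gamma> p p' (SigT A B) \<Longrightarrow> eq_tm lg \<Gamma> (Snd p) (Snd p') (inst_ty B (Fst p))"
| eq_unit_elim: "is_ty lg (UnitT # \<Gamma>) C \<Longrightarrow> eq_tm lg \<Gamma> t t' UnitT \<Longrightarrow>
    eq_tm lg \<Gamma> c c' (inst_ty C Star) \<Longrightarrow>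
    eq_tm lg \<Gamma> (UnitElim t c) (UnitElim t' c') (inst_ty C t)"
| eq_inl: "is_ty lg \<Gamma> A \<Longrightarrow> is_ty lg \<Gamma> B \<Longrightarrow> eq_tm lg \<Gamma> a a' A \<Longrightarrow>
    eq_tm lg \<Gamma> (InL a) (InL a') (SumT A B)"
| eq_inr: "is_ty lg \<Gamma> A \<Longrightarrow> is_ty lg \<Gamma> B \<Longrightarrow> eq_tm lg \<Gamma> b b' B \<Longrightarrow>
    eq_tm lg \<Gamma> (InR b) (InR b') (SumT A B)"
| eq_case: "is_ty lg \<Gamma> A \<Longrightarrow> is_ty lg \<Gamma> B \<Longrightarrow> is_ty lg (SumT A B # \<Gamma>) C \<Longrightarrow>
    eq_tm lg \<Gamma> t t' (SumT A B) \<Longrightarrow>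
    eq_tm lg (A # \<Gamma>) d d' (reinst_ty C (InL (Var 0))) \<Longrightarrow>
    eq_tm lg (B # \<Gamma>) e e' (reinst_ty C (InR (Var 0))) \<Longrightarrow>
    eq_tm lg \<Gamma> (Case t d e) (Case t' d' e') (inst_ty C t)"
| eq_abort: "is_ty lg (EmptyT # \<Gamma>) C \<Longrightarrow> eq_tm lg \<Gamma> t t' EmptyT \<Longrightarrow>
    eq_tm lg \<Gamma> (Abort t) (Abort t') (inst_ty C t)"
| eq_cpi: "has_ty lg \<Gamma> a Univ \<Longrightarrow> eq_tm lg \<Gamma> a a' Univ \<Longrightarrow> eq_tm lg (El a # \<Gamma>) b b' Univ \<Longrightarrow>
    eq_tm lg \<Gamma> (CPi a b) (CPi a' b') Univ"
| eq_csig: "has_ty lg \<Gamma> a Univ \<Longrightarrow> eq_tm lg \<Gamma> a a' Univ \<Longrightarrow> eq_tm lg (El a # \<Gamma>) b b' Univ \<Longrightarrow>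
    eq_tm lg \<Gamma> (CSig a b) (CSig a' b') Univ"
| eq_csum: "eq_tm lg \<Gamma> a a' Univ \<Longrightarrow> eq_tm lg \<Gamma> b b' Univ \<Longrightarrow>
    eq_tm lg \<Gamma> (CSum a b) (CSum a' b') Univ"
| beta_pi: "is_ty lg \<Gamma> A \<Longrightarrow> has_ty lg (A # \<Gamma>) t B \<Longrightarrow> has_ty lg \<Gamma> a A \<Longrightarrow>
    eq_tm lg \<Gamma> (App (Lam t) a) (inst_tm t a) (inst_ty B a)"
| eta_pi: "has_ty lg \<Gamma> t (PiT A B) \<Longrightarrow> eq_tm lg \<Gamma> (Lam (App (lift_tm t) (Var 0))) t (PiT A B)"
| beta_fst: "is_ty lg \<Gamma> A \<Longrightarrow> is_ty lg (A # \<Gamma>) B \<Longrightarrow> has_ty lg \<Gamma> a A \<Longrightarrow>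
    has_ty lg \<Gamma> b (inst_ty B a) \<Longrightarrow> eq_tm lg \<Gamma> (Fst (Pr a b)) a A"
| beta_snd: "is_ty lg \<Gamma> A \<Longrightarrow> is_ty lg (A # \<Gamma>) B \<Longrightarrow> has_ty lg \<Gamma> a A \<Longrightarrow>
    has_ty lg \<Gamma> b (inst_ty B a) \<Longrightarrow> eq_tm lg \<Gamma> (Snd (Pr a b)) b (inst_ty B a)"
| eta_sig: "has_ty lg \<Gamma> p (SigT A B) \<Longrightarrow> eq_tm lg \<Gamma> (Pr (Fst p) (Snd p)) p (SigT A B)"
| beta_unit: "is_ty lg (UnitT # \<Gamma>) C \<Longrightarrow> has_ty lg \<Gamma> c (inst_ty C Star) \<Longrightarrow>
    eq_tm lg \<Gamma> (UnitElim Star c) c (inst_ty C Star)"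
| beta_inl: "is_ty lg \<Gamma> A \<Longrightarrow> is_ty lg \<Gamma> B \<Longrightarrow> is_ty lg (SumT A B # \<Gamma>) C \<Longrightarrow>
    has_ty lg \<Gamma> a A \<Longrightarrow>
    has_ty lg (A # \<Gamma>) d (reinst_ty C (InL (Var 0))) \<Longrightarrow>
    has_ty lg (B # \<Gamma>) e (reinst_ty C (InR (Var 0))) \<Longrightarrow>
    eq_tm lg \<Gamma> (Case (InL a) d e) (inst_tm d a) (inst_ty C (InL a))"
| beta_inr: "is_ty lg \<Gamma> A \<Longrightarrow> is_ty lg \<Gamma> B \<Longrightarrow> is_ty lg (SumT A B # \<Gamma>) C \<Longrightarrow>
    has_ty lg \<Gamma> b B \<Longrightarrow>
    has_ty lg (A # \<Gamma>) d (reinst_ty C (InL (Var 0))) \<Longrightarrow>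
    has_ty lg (B # \<Gamma>) e (reinst_ty C (InR (Var 0))) \<Longrightarrow>
    eq_tm lg \<Gamma> (Case (InR b) d e) (inst_tm e b) (inst_ty C (InR b))"

section \<open>Structures and satisfaction\<close>

text \<open>The iterated application; a sort without arguments is interpreted by a function on \<open>UnitT\<close>.\<close>

definition iapp :: "tm \<Rightarrow> tm list \<Rightarrow> tm" where
  "iapp t us = (if us = [] then App t Star else foldl App t us)"

text \<open>
  \<open>Js\<close> and \<open>gs\<close> list, most recent first, the objects and (after them) the arrows out of \<open>K\<close> whose
  variables are already bound; the variable of an arrow or object is its position in that list.
\<close>

primrec arrows_ty :: "('o, 'a) signature \<Rightarrow> 'o list \<Rightarrow> 'a list \<Rightarrow> 'a list \<Rightarrow> ty" where
  "arrows_ty L Js gs [] = Univ"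
| "arrows_ty L Js gs (f # fs) =
     PiT (El (iapp (Var (length gs + pos (Cod L f) Js))
                   (map (\<lambda>p. Var (pos (Comp L p f) gs)) (arrows_from L (Cod L f)))))
         (arrows_ty L Js (f # gs) fs)"

definition obj_ty :: "('o, 'a) signature \<Rightarrow> 'o list \<Rightarrow> 'o \<Rightarrow> ty" where
  "obj_ty L Js K =
     (if arrows_from L K = [] then fun_ty UnitT Univ else arrows_ty L Js [] (arrows_from L K))"

fun struc_from :: "('o, 'a) signature \<Rightarrow> 'o list \<Rightarrow> 'o list \<Rightarrow> ty" where
  "struc_from L Js [] = UnitT"
| "struc_from L Js [K] = obj_ty L Js K"
| "struc_from L Js (K # K' # Ks) = SigT (obj_ty L Js K) (struc_from L (K # Js) (K' # Ks))"

definition Struc :: "('o, 'a) signature \<Rightarrow> 'o list \<Rightarrow> ty" where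
  "Struc L Ks = struc_from L [] Ks"

definition is_structure :: "logic \<Rightarrow> ('o, 'a) signature \<Rightarrow> 'o list \<Rightarrow> tm \<Rightarrow> bool" where
  "is_structure lg L Ks M \<longleftrightarrow> has_ty lg [] M (Struc L Ks)"

text \<open>The projection of \<open>M\<close> at the object \<open>K\<close>; the equation for the empty list is a dummy.\<close>

fun component :: "'o list \<Rightarrow> tm \<Rightarrow> 'o \<Rightarrow> tm" where
  "component [] M K = M"
| "component [J] M K = M"
| "component (J # J' # Js) M K = (if K = J then Fst M else component (J' # Js) (Snd M) K)"

text \<open>A structure is a closed term, so \<open>component Ks M K\<close> needs no lifting under binders, and a FOLDS
  variable is interpreted by the type-theoretic variable with the same index.\<close>

primrec sort_int :: "'o list \<Rightarrow> tm \<Rightarrow> 'o sort \<Rightarrow> ty" where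
  "sort_int Ks M (Sort K xs) = El (iapp (component Ks M K) (map Var xs))"

definition context_int :: "'o list \<Rightarrow> tm \<Rightarrow> 'o sort list \<Rightarrow> ty list" where
  "context_int Ks M \<Gamma> = map (sort_int Ks M) \<Gamma>"

primrec form_int :: "'o list \<Rightarrow> tm \<Rightarrow> 'o form \<Rightarrow> ty" where
  "form_int Ks M Bot = EmptyT"
| "form_int Ks M Top = UnitT"
| "form_int Ks M (And \<phi> \<psi>) = prod_ty (form_int Ks M \<phi>) (form_int Ks M \<psi>)"
| "form_int Ks M (Or \<phi> \<psi>) = SumT (form_int Ks M \<phi>) (form_int Ks M \<psi>)"
| "form_int Ks M (Imp \<phi> \<psi>) = fun_ty (form_int Ks M \<phi>) (form_int Ks M \<psi>)"
| "form_int Ks M (Forall K \<phi>) = PiT (sort_int Ks M K) (form_int Ks M \<phi>)"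
| "form_int Ks M (Exists K \<phi>) = SigT (sort_int Ks M K) (form_int Ks M \<phi>)"

primrec pis :: "ty list \<Rightarrow> ty \<Rightarrow> ty" where
  "pis [] B = B"
| "pis (A # \<Gamma>) B = pis \<Gamma> (PiT A B)"

primrec satisfies :: "logic \<Rightarrow> 'o list \<Rightarrow> tm \<Rightarrow> 'o sequent \<Rightarrow> bool" where
  "satisfies lg Ks M (Sequent \<Gamma> \<phi> \<psi>) \<longleftrightarrow>
     (\<exists>t. has_ty lg [] t
        (pis (context_int Ks M \<Gamma>) (fun_ty (form_int Ks M \<phi>) (form_int Ks M \<psi>))))"

definition entails ::
  "logic \<Rightarrow> ('o, 'a) signature \<Rightarrow> 'o list \<Rightarrow> 'o sequent set \<Rightarrow> 'o sequent \<Rightarrow> bool" where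
  "entails lg L Ks T \<tau> \<longleftrightarrow>
     (\<forall>M. is_structure lg L Ks M \<longrightarrow> (\<forall>\<sigma>\<in>T. satisfies lg Ks M \<sigma>) \<longrightarrow> satisfies lg Ks M \<tau>)"

end

theory Submission
  imports Defs
begin

text \<open>
  A formula entails another in a structure exactly when the type of functions between their
  interpretations is inhabited over the interpreted context, so each rule of the deductive system
  becomes a closure property of inhabited types.  Substitution, weakening and exchange all rename
  variables along a context morphism; as a structure is a closed term, interpretation commutes with
  renaming, and the three rules reduce to stability of the type-theoretic judgements under renaming.
  The quantifier rules need stability under substitution as well.  Excluded middle is proved by
  applying its inhabitant to a code in the universe for the formula.

  Interpretations are types because the listings of objects and arrows are increasing: when the
  component of a structure at an object is applied to its arguments one after the other, the
  components and arguments on which the type of the next argument depends have been supplied already.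
\<close>

section \<open>Substitution calculus\<close>

lemma up_simps [simp]: "up \<rho> 0 = 0" "up \<rho> (Suc n) = Suc (\<rho> n)"
  by (simp_all add: up_def)

lemma ups_simps [simp]: "ups \<sigma> 0 = Var 0" "ups \<sigma> (Suc n) = lift_tm (\<sigma> n)"
  by (simp_all add: ups_def)

lemma up_comp: "up (\<lambda>i. \<rho> (\<rho>' i)) = (\<lambda>i. up \<rho> (up \<rho>' i))"
  by (rule ext) (simp add: up_def split: nat.split)

text \<open>The fusion laws are proved in a fixed order, because moving one map past a binder needs
  the preceding laws: \<open>ups_ren\<close> rests on \<open>ren_ren_tm\<close>, and
  \<open>ups_sub\<close> on \<open>sub_ren_tm\<close> and \<open>ren_sub_tm\<close>.\<close>

lemma ren_ren_tm [simp]: "ren_tm \<rho> (ren_tm \<rho>' t) = ren_tm (\<lambda>i. \<rho> (\<rho>' i)) t"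
  by (induction t arbitrary: \<rho> \<rho>') (simp_all add: up_comp)

lemma ren_ren_ty [simp]: "ren_ty \<rho> (ren_ty \<rho>' A) = ren_ty (\<lambda>i. \<rho> (\<rho>' i)) A"
  by (induction A arbitrary: \<rho> \<rho>') (simp_all add: up_comp)

lemma ups_up: "ups (\<lambda>i. \<sigma> (\<rho> i)) = (\<lambda>i. ups \<sigma> (up \<rho> i))"
  by (rule ext) (simp add: ups_def up_def split: nat.split)

lemma sub_ren_tm [simp]: "sub_tm \<sigma> (ren_tm \<rho> t) = sub_tm (\<lambda>i. \<sigma> (\<rho> i)) t"
  by (induction t arbitrary: \<sigma> \<rho>) (simp_all add: ups_up)

lemma sub_ren_ty [simp]: "sub_ty \<sigma> (ren_ty \<rho> A) = sub_ty (\<lambda>i. \<sigma> (\<rho> i)) A"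
  by (induction A arbitrary: \<sigma> \<rho>) (simp_all add: ups_up)

lemma ups_ren: "ups (\<lambda>i. ren_tm \<rho> (\<sigma> i)) = (\<lambda>i. ren_tm (up \<rho>) (ups \<sigma> i))"
  by (rule ext) (simp add: ups_def split: nat.split)

lemma ren_sub_tm [simp]: "ren_tm \<rho> (sub_tm \<sigma> t) = sub_tm (\<lambda>i. ren_tm \<rho> (\<sigma> i)) t"
  by (induction t arbitrary: \<sigma> \<rho>) (simp_all add: ups_ren)

lemma ren_sub_ty [simp]: "ren_ty \<rho> (sub_ty \<sigma> A) = sub_ty (\<lambda>i. ren_tm \<rho> (\<sigma> i)) A"
  by (induction A arbitrary: \<sigma> \<rho>) (simp_all add: ups_ren)

lemma ups_sub: "ups (\<lambda>i. sub_tm \<sigma> (\<sigma>' i)) = (\<lambda>i. sub_tm (ups \<sigma>) (ups \<sigma>' i))"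
  by (rule ext) (simp add: ups_def split: nat.split)

lemma sub_sub_tm [simp]: "sub_tm \<sigma> (sub_tm \<sigma>' t) = sub_tm (\<lambda>i. sub_tm \<sigma> (\<sigma>' i)) t"
  by (induction t arbitrary: \<sigma> \<sigma>') (simp_all add: ups_sub)

lemma sub_sub_ty [simp]: "sub_ty \<sigma> (sub_ty \<sigma>' A) = sub_ty (\<lambda>i. sub_tm \<sigma> (\<sigma>' i)) A"
  by (induction A arbitrary: \<sigma> \<sigma>') (simp_all add: ups_sub)

lemma ups_Var [simp]: "ups Var = Var"
  by (rule ext) (simp add: ups_def split: nat.split)

lemma sub_tm_Var [simp]: "sub_tm Var t = t"
  by (induction t) simp_all

lemma sub_ty_Var [simp]: "sub_ty Var A = A"
  by (induction A) simp_all

lemma ups_Var_ren: "ups (\<lambda>i. Var (\<rho> i)) = (\<lambda>i. Var (up \<rho> i))"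
  by (rule ext) (simp add: ups_def up_def split: nat.split)

lemma ren_tm_as_sub: "ren_tm \<rho> t = sub_tm (\<lambda>i. Var (\<rho> i)) t"
  by (induction t arbitrary: \<rho>) (simp_all add: ups_Var_ren)

lemma ren_ty_as_sub: "ren_ty \<rho> A = sub_ty (\<lambda>i. Var (\<rho> i)) A"
  by (induction A arbitrary: \<rho>) (simp_all add: ups_Var_ren ren_tm_as_sub)

text \<open>The substitutions in the instantiation laws are defined by cases on the index: index 0
  is the variable being instantiated, successors are the surrounding context. Comparing them
  separately there avoids any case split inside the abstraction.\<close>

lemma sub_tm_cong_nat: "\<sigma> 0 = \<tau> 0 \<Longrightarrow> (\<And>n. \<sigma> (Suc n) = \<tau> (Suc n)) \<Longrightarrow> sub_tm \<sigma> t = sub_tm \<tau> t"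
  by (rule arg_cong[where f = "\<lambda>\<sigma>. sub_tm \<sigma> t"], rule ext, case_tac x) auto

lemma sub_ty_cong_nat: "\<sigma> 0 = \<tau> 0 \<Longrightarrow> (\<And>n. \<sigma> (Suc n) = \<tau> (Suc n)) \<Longrightarrow> sub_ty \<sigma> A = sub_ty \<tau> A"
  by (rule arg_cong[where f = "\<lambda>\<sigma>. sub_ty \<sigma> A"], rule ext, case_tac x) auto

lemma ren_inst_ty [simp]: "ren_ty \<rho> (inst_ty B a) = inst_ty (ren_ty (up \<rho>) B) (ren_tm \<rho> a)"
  unfolding inst_ty_def by (simp, rule sub_ty_cong_nat) simp_all

lemma ren_inst_tm [simp]: "ren_tm \<rho> (inst_tm t a) = inst_tm (ren_tm (up \<rho>) t) (ren_tm \<rho> a)"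
  unfolding inst_tm_def by (simp, rule sub_tm_cong_nat) simp_all

lemma ren_reinst_ty [simp]:
  "ren_ty (up \<rho>) (reinst_ty C c) = reinst_ty (ren_ty (up \<rho>) C) (ren_tm (up \<rho>) c)"
  unfolding reinst_ty_def by (simp, rule sub_ty_cong_nat) simp_all

lemma sub_inst_ty: "sub_ty \<sigma> (inst_ty B a) = sub_ty (case_nat (sub_tm \<sigma> a) \<sigma>) B"
  unfolding inst_ty_def by (simp, rule sub_ty_cong_nat) simp_all

text \<open>Each application of a function and each second projection extends the current
  substitution by one entry. This is how the type of a component is tracked while its arguments are
  supplied.\<close>

lemma inst_sub_ups_ty: "inst_ty (sub_ty (ups \<sigma>) B) a = sub_ty (case_nat a \<sigma>) B"
  unfolding inst_ty_def
  by (simp, rule sub_ty_cong_nat) (simp_all)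

lemma inst_sub_ups_tm: "inst_tm (sub_tm (ups \<sigma>) t) a = sub_tm (case_nat a \<sigma>) t"
  unfolding inst_tm_def
  by (simp, rule sub_tm_cong_nat) (simp_all)

lemma sub_inst_tm: "sub_tm \<sigma> (inst_tm t a) = inst_tm (sub_tm (ups \<sigma>) t) (sub_tm \<sigma> a)"
  unfolding inst_sub_ups_tm unfolding inst_tm_def by (simp, rule sub_tm_cong_nat) simp_all

lemma sub_inst_ty_ups: "sub_ty \<sigma> (inst_ty B a) = inst_ty (sub_ty (ups \<sigma>) B) (sub_tm \<sigma> a)"
  by (simp add: sub_inst_ty inst_sub_ups_ty)

lemma sub_reinst_ty:
  "sub_ty (ups \<sigma>) (reinst_ty C c) = reinst_ty (sub_ty (ups \<sigma>) C) (sub_tm (ups \<sigma>) c)"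
  unfolding reinst_ty_def
  by (simp, rule sub_ty_cong_nat) (simp_all add: ren_tm_as_sub)

lemma inst_lift_ty [simp]: "inst_ty (lift_ty B) a = B"
  by (simp add: inst_ty_def)

text \<open>Although fusion proves this at once, it serves as a rewrite rule when fusion is switched
  off: in the case of \<open>eta_pi\<close> the result must keep a visible \<open>lift_tm\<close>
  for the rule to match. \<open>sub_ups_lift_tm\<close> does the same for substitutions.\<close>

lemma ren_up_lift_tm: "ren_tm (up \<rho>) (lift_tm t) = lift_tm (ren_tm \<rho> t)"
  by simp

lemma sub_ups_lift_tm: "sub_tm (ups \<sigma>) (lift_tm t) = lift_tm (sub_tm \<sigma> t)"
  by simp

lemma ren_fun_ty [simp]: "ren_ty \<rho> (fun_ty A B) = fun_ty (ren_ty \<rho> A) (ren_ty \<rho> B)"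
  by (simp add: fun_ty_def)

lemma ren_prod_ty [simp]: "ren_ty \<rho> (prod_ty A B) = prod_ty (ren_ty \<rho> A) (ren_ty \<rho> B)"
  by (simp add: prod_ty_def)

lemma sub_fun_ty [simp]: "sub_ty \<sigma> (fun_ty A B) = fun_ty (sub_ty \<sigma> A) (sub_ty \<sigma> B)"
  by (simp add: fun_ty_def)

lemma ren_lem_ty [simp]: "ren_ty \<rho> lem_ty = lem_ty"
  by (simp add: lem_ty_def)

lemma sub_lem_ty [simp]: "sub_ty \<sigma> lem_ty = lem_ty"
  by (simp add: lem_ty_def)

section \<open>Stability of judgements under renaming and substitution\<close>

text \<open>Entries of a context live in the contexts behind them, so both types are first weakened
  to the full contexts before they are compared. Well-formedness of the target is included because
  variables and the closed formers demand it.\<close>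

definition renames :: "logic \<Rightarrow> ty list \<Rightarrow> (nat \<Rightarrow> nat) \<Rightarrow> ty list \<Rightarrow> bool" where
  "renames lg \<Delta> \<rho> \<Gamma> \<longleftrightarrow> is_ctx lg \<Delta> \<and>
     (\<forall>i<length \<Gamma>. \<rho> i < length \<Delta> \<and>
        ren_ty (\<lambda>n. n + Suc (\<rho> i)) (\<Delta> ! \<rho> i) = ren_ty \<rho> (ren_ty (\<lambda>n. n + Suc i) (\<Gamma> ! i)))"

lemma renames_up:
  assumes "renames lg \<Delta> \<rho> \<Gamma>" "is_ty lg \<Delta> (ren_ty \<rho> A)"
  shows "renames lg (ren_ty \<rho> A # \<Delta>) (up \<rho>) (A # \<Gamma>)"
  unfolding renames_def
proof (intro conjI allI impI)
  show "is_ctx lg (ren_ty \<rho> A # \<Delta>)"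
    using assms ctx_cons unfolding renames_def by blast
next
  fix i assume i: "i < length (A # \<Gamma>)"
  show "up \<rho> i < length (ren_ty \<rho> A # \<Delta>)"
    using assms i by (cases i) (auto simp: renames_def)
  show "ren_ty (\<lambda>n. n + Suc (up \<rho> i)) ((ren_ty \<rho> A # \<Delta>) ! up \<rho> i) =
        ren_ty (up \<rho>) (ren_ty (\<lambda>n. n + Suc i) ((A # \<Gamma>) ! i))"
  proof (cases i)
    case 0
    then show ?thesis by simp
  next
    case (Suc j)
    then have "ren_ty (\<lambda>n. n + Suc (\<rho> j)) (\<Delta> ! \<rho> j) = ren_ty \<rho> (ren_ty (\<lambda>n. n + Suc j) (\<Gamma> ! j))"
      using assms i by (auto simp: renames_def)
    from arg_cong[OF this, of lift_ty] show ?thesis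
      using Suc by simp
  qed
qed

lemma renames_imp_is_ctx: "renames lg \<Delta> \<rho> \<Gamma> \<Longrightarrow> is_ctx lg \<Delta>"
  by (simp add: renames_def)

lemma renames_var: "renames lg \<Delta> \<rho> \<Gamma> \<Longrightarrow> i < length \<Gamma> \<Longrightarrow>
  has_ty lg \<Delta> (Var (\<rho> i)) (ren_ty \<rho> (ren_ty (\<lambda>n. n + Suc i) (\<Gamma> ! i)))"
  unfolding renames_def using tm_var[of lg \<Delta> "\<rho> i"] by auto

lemmas judgement_inducts = is_ctx_is_ty_eq_ty_has_ty_eq_tm.inducts

text \<open>These rules have a particular former in their conclusion, so that shape selects the
  rule. The conversion rules match any judgement of their kind and are therefore kept apart and
  applied by name.\<close>

lemmas structural_rules =
  ty_univ ty_el ty_pi ty_sig ty_unit ty_sum ty_empty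
  eqty_el eqty_pi eqty_sig eqty_sum el_pi el_sig el_unit el_sum el_empty
  tm_lam tm_app tm_pair tm_fst tm_snd tm_star tm_unit_elim tm_inl tm_inr tm_case tm_abort
  tm_cpi tm_csig tm_cunit tm_csum tm_cempty tm_lem
  eq_lam eq_app eq_pair eq_fst eq_snd eq_unit_elim eq_inl eq_inr eq_case eq_abort
  eq_cpi eq_csig eq_csum beta_pi eta_pi beta_fst beta_snd eta_sig beta_unit beta_inl beta_inr

lemmas sum_elim_rules = tm_case eq_case beta_inl beta_inr

lemmas conversion_rules = eqty_refl eqty_sym eqty_trans tm_conv eq_refl eq_sym eq_trans eq_conv

lemma renames_up_closed:
  "renames lg \<Delta> \<rho> \<Gamma> \<Longrightarrow> renames lg (UnitT # \<Delta>) (up \<rho>) (UnitT # \<Gamma>)"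
  "renames lg \<Delta> \<rho> \<Gamma> \<Longrightarrow> renames lg (EmptyT # \<Delta>) (up \<rho>) (EmptyT # \<Gamma>)"
  using renames_up[of lg \<Delta> \<rho> \<Gamma> UnitT] renames_up[of lg \<Delta> \<rho> \<Gamma> EmptyT]
  by (auto intro: ty_unit ty_empty renames_imp_is_ctx)

lemma renames_up_El:
  "renames lg \<Delta> \<rho> \<Gamma> \<Longrightarrow> has_ty lg \<Delta> (ren_tm \<rho> a) Univ \<Longrightarrow>
   renames lg (El (ren_tm \<rho> a) # \<Delta>) (up \<rho>) (El a # \<Gamma>)"
  using renames_up[of lg \<Delta> \<rho> \<Gamma> "El a"] by (auto intro: ty_el)

lemma renames_up_SumT:
  "renames lg \<Delta> \<rho> \<Gamma> \<Longrightarrow> is_ty lg \<Delta> (ren_ty \<rho> A) \<Longrightarrow> is_ty lg \<Delta> (ren_ty \<rho> B) \<Longrightarrow>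
   renames lg (SumT (ren_ty \<rho> A) (ren_ty \<rho> B) # \<Delta>) (up \<rho>) (SumT A B # \<Gamma>)"
  using renames_up[of lg \<Delta> \<rho> \<Gamma> "SumT A B"] by (auto intro: ty_sum)

lemmas renames_intros = renames_imp_is_ctx renames_up renames_up_closed renames_up_El renames_up_SumT

text \<open>Simultaneous induction on the judgements, with target and renaming arbitrary because
  binders lift them. Each binding rule has a premise making the bound type well formed, or binds a
  closed type, and this is what allows the renaming to be lifted. Contexts contribute nothing, as
  the target is well formed by \<open>renames\<close>.\<close>

lemma renaming:
  shows "is_ctx lg \<Gamma> \<Longrightarrow> True"
    and is_ty_ren: "is_ty lg \<Gamma> A \<Longrightarrow> renames lg \<Delta> \<rho> \<Gamma> \<Longrightarrow> is_ty lg \<Delta> (ren_ty \<rho> A)"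
    and eq_ty_ren: "eq_ty lg \<Gamma> A B \<Longrightarrow> renames lg \<Delta> \<rho> \<Gamma> \<Longrightarrow>
      eq_ty lg \<Delta> (ren_ty \<rho> A) (ren_ty \<rho> B)"
    and has_ty_ren: "has_ty lg \<Gamma> t A \<Longrightarrow> renames lg \<Delta> \<rho> \<Gamma> \<Longrightarrow>
      has_ty lg \<Delta> (ren_tm \<rho> t) (ren_ty \<rho> A)"
    and eq_tm_ren: "eq_tm lg \<Gamma> t u A \<Longrightarrow> renames lg \<Delta> \<rho> \<Gamma> \<Longrightarrow>
      eq_tm lg \<Delta> (ren_tm \<rho> t) (ren_tm \<rho> u) (ren_ty \<rho> A)"
proof (induction arbitrary: and \<Delta> \<rho> and \<Delta> \<rho> and \<Delta> \<rho> and \<Delta> \<rho>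
    rule: judgement_inducts)
  case (tm_var \<Gamma> i)
  then show ?case using renames_var by simp
next
  case eqty_refl
  then show ?case by (meson conversion_rules(1))
next
  case eqty_sym
  then show ?case by (meson conversion_rules(2))
next
  case eqty_trans
  then show ?case by (meson conversion_rules(3))
next
  case tm_conv
  then show ?case by (meson conversion_rules(4))
next
  case eq_refl
  then show ?case by (meson conversion_rules(5))
next
  case eq_sym
  then show ?case by (meson conversion_rules(6))
next
  case eq_trans
  then show ?case by (meson conversion_rules(7))
next
  case eq_conv
  then show ?case by (meson conversion_rules(8))
next
  case eta_pi
  then show ?case
    by - (simp add: ren_up_lift_tm del: ren_ren_tm, rule structural_rules, blast)
next
  \<comment> \<open>\<open>reinst_ty\<close> commutes only with lifted renamings, so here the induction hypotheses have to be
    instantiated by hand.\<close>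
  case (tm_case \<Gamma> A B C t d e)
  have r: "renames lg (ren_ty \<rho> A # \<Delta>) (up \<rho>) (A # \<Gamma>)"
    "renames lg (ren_ty \<rho> B # \<Delta>) (up \<rho>) (B # \<Gamma>)"
    "renames lg (SumT (ren_ty \<rho> A) (ren_ty \<rho> B) # \<Delta>) (up \<rho>) (SumT A B # \<Gamma>)"
    by (intro renames_up renames_up_SumT tm_case.prems tm_case.IH(2,4)[OF tm_case.prems])+
  show ?case
    using sum_elim_rules(1)[OF tm_case.IH(2,4)[OF tm_case.prems] tm_case.IH(6)[OF r(3)]
      tm_case.IH(8)[OF tm_case.prems, simplified]
      tm_case.IH(10)[OF r(1), simplified]
      tm_case.IH(12)[OF r(2), simplified]]
    by simp
next
  case (eq_case \<Gamma> A B C t t' d d' e e')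
  have r: "renames lg (ren_ty \<rho> A # \<Delta>) (up \<rho>) (A # \<Gamma>)"
    "renames lg (ren_ty \<rho> B # \<Delta>) (up \<rho>) (B # \<Gamma>)"
    "renames lg (SumT (ren_ty \<rho> A) (ren_ty \<rho> B) # \<Delta>) (up \<rho>) (SumT A B # \<Gamma>)"
    by (intro renames_up renames_up_SumT eq_case.prems eq_case.IH(2,4)[OF eq_case.prems])+
  show ?case
    using sum_elim_rules(2)[OF eq_case.IH(2,4)[OF eq_case.prems] eq_case.IH(6)[OF r(3)]
      eq_case.IH(8)[OF eq_case.prems, simplified]
      eq_case.IH(10)[OF r(1), simplified]
      eq_case.IH(12)[OF r(2), simplified]]
    by simp
next
  case (beta_inl \<Gamma> A B C a d e)
  have r: "renames lg (ren_ty \<rho> A # \<Delta>) (up \<rho>) (A # \<Gamma>)"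
    "renames lg (ren_ty \<rho> B # \<Delta>) (up \<rho>) (B # \<Gamma>)"
    "renames lg (SumT (ren_ty \<rho> A) (ren_ty \<rho> B) # \<Delta>) (up \<rho>) (SumT A B # \<Gamma>)"
    by (intro renames_up renames_up_SumT beta_inl.prems beta_inl.IH(2,4)[OF beta_inl.prems])+
  show ?case
    using sum_elim_rules(3)[OF beta_inl.IH(2,4)[OF beta_inl.prems] beta_inl.IH(6)[OF r(3)]
      beta_inl.IH(8)[OF beta_inl.prems, simplified]
      beta_inl.IH(10)[OF r(1), simplified]
      beta_inl.IH(12)[OF r(2), simplified]]
    by simp
next
  case (beta_inr \<Gamma> A B C b d e)
  have r: "renames lg (ren_ty \<rho> A # \<Delta>) (up \<rho>) (A # \<Gamma>)"
    "renames lg (ren_ty \<rho> B # \<Delta>) (up \<rho>) (B # \<Gamma>)"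
    "renames lg (SumT (ren_ty \<rho> A) (ren_ty \<rho> B) # \<Delta>) (up \<rho>) (SumT A B # \<Gamma>)"
    by (intro renames_up renames_up_SumT beta_inr.prems beta_inr.IH(2,4)[OF beta_inr.prems])+
  show ?case
    using sum_elim_rules(4)[OF beta_inr.IH(2,4)[OF beta_inr.prems] beta_inr.IH(6)[OF r(3)]
      beta_inr.IH(8)[OF beta_inr.prems, simplified]
      beta_inr.IH(10)[OF r(1), simplified]
      beta_inr.IH(12)[OF r(2), simplified]]
    by simp
qed (simp; (rule structural_rules; blast intro: renames_intros))+

section \<open>Stability under substitution\<close>

definition substitutes :: "logic \<Rightarrow> ty list \<Rightarrow> (nat \<Rightarrow> tm) \<Rightarrow> ty list \<Rightarrow> bool" where
  "substitutes lg \<Delta> \<sigma> \<Gamma> \<longleftrightarrow> is_ctx lg \<Delta> \<and>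
     (\<forall>i<length \<Gamma>. has_ty lg \<Delta> (\<sigma> i) (sub_ty (\<lambda>n. \<sigma> (n + Suc i)) (\<Gamma> ! i)))"

lemma renames_Suc: "is_ctx lg \<Gamma> \<Longrightarrow> is_ty lg \<Gamma> A \<Longrightarrow> renames lg (A # \<Gamma>) Suc \<Gamma>"
  unfolding renames_def by (simp add: ctx_cons)

lemma substitutes_imp_is_ctx: "substitutes lg \<Delta> \<sigma> \<Gamma> \<Longrightarrow> is_ctx lg \<Delta>"
  by (simp add: substitutes_def)

lemma substitutes_var: "substitutes lg \<Delta> \<sigma> \<Gamma> \<Longrightarrow> i < length \<Gamma> \<Longrightarrow>
  has_ty lg \<Delta> (\<sigma> i) (sub_ty \<sigma> (ren_ty (\<lambda>n. n + Suc i) (\<Gamma> ! i)))"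
  by (simp add: substitutes_def)

text \<open>This is where renaming has to come first: the substituted terms enter an extended
  context and must be weakened there, which is \<open>has_ty_ren\<close> along
  \<open>Suc\<close>.\<close>

lemma substitutes_up:
  assumes "substitutes lg \<Delta> \<sigma> \<Gamma>" "is_ty lg \<Delta> (sub_ty \<sigma> A)"
  shows "substitutes lg (sub_ty \<sigma> A # \<Delta>) (ups \<sigma>) (A # \<Gamma>)"
  unfolding substitutes_def
proof (intro conjI allI impI)
  show c: "is_ctx lg (sub_ty \<sigma> A # \<Delta>)"
    using assms ctx_cons unfolding substitutes_def by blast
  fix i assume i: "i < length (A # \<Gamma>)"
  show "has_ty lg (sub_ty \<sigma> A # \<Delta>) (ups \<sigma> i) (sub_ty (\<lambda>n. ups \<sigma> (n + Suc i)) ((A # \<Gamma>) ! i))"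
  proof (cases i)
    case 0
    then show ?thesis
      using tm_var[OF c, of 0] by simp
  next
    case (Suc j)
    then have "has_ty lg \<Delta> (\<sigma> j) (sub_ty (\<lambda>n. \<sigma> (n + Suc j)) (\<Gamma> ! j))"
      using assms i by (auto simp: substitutes_def)
    moreover have "renames lg (sub_ty \<sigma> A # \<Delta>) Suc \<Delta>"
      using assms renames_Suc unfolding substitutes_def by blast
    ultimately show ?thesis
      using has_ty_ren Suc by fastforce
  qed
qed

lemma substitutes_up_closed:
  "substitutes lg \<Delta> \<sigma> \<Gamma> \<Longrightarrow> substitutes lg (UnitT # \<Delta>) (ups \<sigma>) (UnitT # \<Gamma>)"
  "substitutes lg \<Delta> \<sigma> \<Gamma> \<Longrightarrow> substitutes lg (EmptyT # \<Delta>) (ups \<sigma>) (EmptyT # \<Gamma>)"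
  using substitutes_up[of lg \<Delta> \<sigma> \<Gamma> UnitT] substitutes_up[of lg \<Delta> \<sigma> \<Gamma> EmptyT]
  by (auto intro: ty_unit ty_empty substitutes_imp_is_ctx)

lemma substitutes_up_El:
  "substitutes lg \<Delta> \<sigma> \<Gamma> \<Longrightarrow> has_ty lg \<Delta> (sub_tm \<sigma> a) Univ \<Longrightarrow>
   substitutes lg (El (sub_tm \<sigma> a) # \<Delta>) (ups \<sigma>) (El a # \<Gamma>)"
  using substitutes_up[of lg \<Delta> \<sigma> \<Gamma> "El a"] by (auto intro: ty_el)

lemma substitutes_up_SumT:
  "substitutes lg \<Delta> \<sigma> \<Gamma> \<Longrightarrow> is_ty lg \<Delta> (sub_ty \<sigma> A) \<Longrightarrow> is_ty lg \<Delta> (sub_ty \<sigma> B) \<Longrightarrow>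
   substitutes lg (SumT (sub_ty \<sigma> A) (sub_ty \<sigma> B) # \<Delta>) (ups \<sigma>) (SumT A B # \<Gamma>)"
  using substitutes_up[of lg \<Delta> \<sigma> \<Gamma> "SumT A B"] by (auto intro: ty_sum)

lemmas substitutes_intros =
  substitutes_imp_is_ctx substitutes_up substitutes_up_closed substitutes_up_El substitutes_up_SumT

lemma substitution:
  shows "is_ctx lg \<Gamma> \<Longrightarrow> True"
    and is_ty_sub: "is_ty lg \<Gamma> A \<Longrightarrow> substitutes lg \<Delta> \<sigma> \<Gamma> \<Longrightarrow> is_ty lg \<Delta> (sub_ty \<sigma> A)"
    and eq_ty_sub: "eq_ty lg \<Gamma> A B \<Longrightarrow> substitutes lg \<Delta> \<sigma> \<Gamma> \<Longrightarrow>
      eq_ty lg \<Delta> (sub_ty \<sigma> A) (sub_ty \<sigma> B)"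
    and has_ty_sub: "has_ty lg \<Gamma> t A \<Longrightarrow> substitutes lg \<Delta> \<sigma> \<Gamma> \<Longrightarrow>
      has_ty lg \<Delta> (sub_tm \<sigma> t) (sub_ty \<sigma> A)"
    and eq_tm_sub: "eq_tm lg \<Gamma> t u A \<Longrightarrow> substitutes lg \<Delta> \<sigma> \<Gamma> \<Longrightarrow>
      eq_tm lg \<Delta> (sub_tm \<sigma> t) (sub_tm \<sigma> u) (sub_ty \<sigma> A)"
proof (induction arbitrary: and \<Delta> \<sigma> and \<Delta> \<sigma> and \<Delta> \<sigma> and \<Delta> \<sigma>
    rule: judgement_inducts)
  case (tm_var \<Gamma> i)
  then show ?case using substitutes_var by simp
next
  case eqty_refl
  then show ?case by (meson conversion_rules(1))
next
  case eqty_sym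
  then show ?case by (meson conversion_rules(2))
next
  case eqty_trans
  then show ?case by (meson conversion_rules(3))
next
  case tm_conv
  then show ?case by (meson conversion_rules(4))
next
  case eq_refl
  then show ?case by (meson conversion_rules(5))
next
  case eq_sym
  then show ?case by (meson conversion_rules(6))
next
  case eq_trans
  then show ?case by (meson conversion_rules(7))
next
  case eq_conv
  then show ?case by (meson conversion_rules(8))
next
  case eta_pi
  then show ?case
    by - (simp add: sub_ups_lift_tm del: sub_ren_tm ren_sub_tm, rule structural_rules, blast)
next
  case (tm_case \<Gamma> A B C t d e)
  have r: "substitutes lg (sub_ty \<sigma> A # \<Delta>) (ups \<sigma>) (A # \<Gamma>)"
    "substitutes lg (sub_ty \<sigma> B # \<Delta>) (ups \<sigma>) (B # \<Gamma>)"
    "substitutes lg (SumT (sub_ty \<sigma> A) (sub_ty \<sigma> B) # \<Delta>) (ups \<sigma>) (SumT A B # \<Gamma>)"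
    by (intro substitutes_up substitutes_up_SumT tm_case.prems tm_case.IH(2,4)[OF tm_case.prems])+
  \<comment> \<open>Only the listed equations are used on the branches, so that the substitution
    moves inside \<open>reinst_ty\<close> and the branch types keep the form that the elimination
    rule expects.\<close>
  show ?case
    using sum_elim_rules(1)[OF tm_case.IH(2,4)[OF tm_case.prems] tm_case.IH(6)[OF r(3)]
      tm_case.IH(8)[OF tm_case.prems, simplified]
      tm_case.IH(10)[OF r(1), simplified sub_reinst_ty sub_tm.simps ups_simps]
      tm_case.IH(12)[OF r(2), simplified sub_reinst_ty sub_tm.simps ups_simps]]
    by (simp add: sub_inst_ty_ups sub_inst_tm)
next
  case (eq_case \<Gamma> A B C t t' d d' e e')
  have r: "substitutes lg (sub_ty \<sigma> A # \<Delta>) (ups \<sigma>) (A # \<Gamma>)"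
    "substitutes lg (sub_ty \<sigma> B # \<Delta>) (ups \<sigma>) (B # \<Gamma>)"
    "substitutes lg (SumT (sub_ty \<sigma> A) (sub_ty \<sigma> B) # \<Delta>) (ups \<sigma>) (SumT A B # \<Gamma>)"
    by (intro substitutes_up substitutes_up_SumT eq_case.prems eq_case.IH(2,4)[OF eq_case.prems])+
  show ?case
    using sum_elim_rules(2)[OF eq_case.IH(2,4)[OF eq_case.prems] eq_case.IH(6)[OF r(3)]
      eq_case.IH(8)[OF eq_case.prems, simplified]
      eq_case.IH(10)[OF r(1), simplified sub_reinst_ty sub_tm.simps ups_simps]
      eq_case.IH(12)[OF r(2), simplified sub_reinst_ty sub_tm.simps ups_simps]]
    by (simp add: sub_inst_ty_ups sub_inst_tm)
next
  case (beta_inl \<Gamma> A B C a d e)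
  have r: "substitutes lg (sub_ty \<sigma> A # \<Delta>) (ups \<sigma>) (A # \<Gamma>)"
    "substitutes lg (sub_ty \<sigma> B # \<Delta>) (ups \<sigma>) (B # \<Gamma>)"
    "substitutes lg (SumT (sub_ty \<sigma> A) (sub_ty \<sigma> B) # \<Delta>) (ups \<sigma>) (SumT A B # \<Gamma>)"
    by (intro substitutes_up substitutes_up_SumT beta_inl.prems beta_inl.IH(2,4)[OF beta_inl.prems])+
  show ?case
    using sum_elim_rules(3)[OF beta_inl.IH(2,4)[OF beta_inl.prems] beta_inl.IH(6)[OF r(3)]
      beta_inl.IH(8)[OF beta_inl.prems, simplified]
      beta_inl.IH(10)[OF r(1), simplified sub_reinst_ty sub_tm.simps ups_simps]
      beta_inl.IH(12)[OF r(2), simplified sub_reinst_ty sub_tm.simps ups_simps]]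
    by (simp add: sub_inst_ty_ups sub_inst_tm)
next
  case (beta_inr \<Gamma> A B C b d e)
  have r: "substitutes lg (sub_ty \<sigma> A # \<Delta>) (ups \<sigma>) (A # \<Gamma>)"
    "substitutes lg (sub_ty \<sigma> B # \<Delta>) (ups \<sigma>) (B # \<Gamma>)"
    "substitutes lg (SumT (sub_ty \<sigma> A) (sub_ty \<sigma> B) # \<Delta>) (ups \<sigma>) (SumT A B # \<Gamma>)"
    by (intro substitutes_up substitutes_up_SumT beta_inr.prems beta_inr.IH(2,4)[OF beta_inr.prems])+
  show ?case
    using sum_elim_rules(4)[OF beta_inr.IH(2,4)[OF beta_inr.prems] beta_inr.IH(6)[OF r(3)]
      beta_inr.IH(8)[OF beta_inr.prems, simplified]
      beta_inr.IH(10)[OF r(1), simplified sub_reinst_ty sub_tm.simps ups_simps]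
      beta_inr.IH(12)[OF r(2), simplified sub_reinst_ty sub_tm.simps ups_simps]]
    by (simp add: sub_inst_ty_ups sub_inst_tm)
qed (simp add: sub_inst_ty_ups sub_inst_tm; (rule structural_rules; blast intro: substitutes_intros))+

section \<open>Well-formed contexts, closed terms and instantiation\<close>

lemma is_ctx_ConsD: "is_ctx lg (A # \<Gamma>) \<Longrightarrow> is_ctx lg \<Gamma> \<and> is_ty lg \<Gamma> A"
  by (erule is_ctx.cases) auto

lemma judgement_imp_is_ctx:
  shows "is_ctx lg \<Gamma> \<Longrightarrow> True"
    and is_ty_imp_is_ctx: "is_ty lg \<Gamma> A \<Longrightarrow> is_ctx lg \<Gamma>"
    and eq_ty_imp_is_ctx: "eq_ty lg \<Gamma> A B \<Longrightarrow> is_ctx lg \<Gamma>"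
    and has_ty_imp_is_ctx: "has_ty lg \<Gamma> t A \<Longrightarrow> is_ctx lg \<Gamma>"
    and eq_tm_imp_is_ctx: "eq_tm lg \<Gamma> t u A \<Longrightarrow> is_ctx lg \<Gamma>"
  by (induction rule: judgement_inducts) simp_all

lemma ups_scoped: "\<forall>i<n. \<sigma> i = Var i \<Longrightarrow> \<forall>i<Suc n. ups \<sigma> i = Var i"
  by (auto simp: less_Suc_eq_0_disj)

text \<open>A typed term mentions only variables of its context. The case of interest is the empty
  context: a structure is fixed by every substitution. Only the typing judgement carries information
  in the induction.\<close>

lemma sub_tm_scoped:
  shows "is_ctx lg \<Gamma> \<Longrightarrow> True"
    and "is_ty lg \<Gamma> A \<Longrightarrow> True"
    and "eq_ty lg \<Gamma> A B \<Longrightarrow> True"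
    and has_ty_sub_id: "has_ty lg \<Gamma> t A \<Longrightarrow> \<forall>i<length \<Gamma>. \<sigma> i = Var i \<Longrightarrow> sub_tm \<sigma> t = t"
    and "eq_tm lg \<Gamma> t u A \<Longrightarrow> True"
  by (induction arbitrary: and and and \<sigma> rule: judgement_inducts)
    (simp_all add: ups_scoped)

lemma is_ctx_lift: "is_ty lg \<Gamma> A \<Longrightarrow> is_ctx lg (A # \<Gamma>)"
  using ctx_cons is_ty_imp_is_ctx by blast

lemma renames_lift: "is_ty lg \<Gamma> A \<Longrightarrow> renames lg (A # \<Gamma>) Suc \<Gamma>"
  using renames_Suc is_ty_imp_is_ctx by blast

lemma is_ty_lift: "is_ty lg \<Gamma> A \<Longrightarrow> is_ty lg \<Gamma> B \<Longrightarrow> is_ty lg (A # \<Gamma>) (lift_ty B)"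
  using is_ty_ren renames_lift by blast

lemma is_ty_fun: "is_ty lg \<Gamma> A \<Longrightarrow> is_ty lg \<Gamma> B \<Longrightarrow> is_ty lg \<Gamma> (fun_ty A B)"
  unfolding fun_ty_def by (blast intro: ty_pi is_ty_lift)

lemma is_ty_prod: "is_ty lg \<Gamma> A \<Longrightarrow> is_ty lg \<Gamma> B \<Longrightarrow> is_ty lg \<Gamma> (prod_ty A B)"
  unfolding prod_ty_def by (blast intro: ty_sig is_ty_lift)

lemma substitutes_inst:
  assumes "has_ty lg \<Gamma> a A"
  shows "substitutes lg \<Gamma> (case_nat a Var) (A # \<Gamma>)"
  unfolding substitutes_def
proof (intro conjI allI impI)
  show "is_ctx lg \<Gamma>"
    using assms has_ty_imp_is_ctx by blast
  fix i assume "i < length (A # \<Gamma>)"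
  \<comment> \<open>Index 0 receives \<open>a\<close>; a later index \<open>i\<close> is sent to the
    variable \<open>i - 1\<close> of \<Gamma>, whose declared type is a weakening, rewritten as a
    substitution by variables.\<close>
  then show "has_ty lg \<Gamma> (case_nat a Var i) (sub_ty (\<lambda>n. case_nat a Var (n + Suc i)) ((A # \<Gamma>) ! i))"
    using assms tm_var[OF has_ty_imp_is_ctx[OF assms], of "i - 1"]
    by (cases i) (simp_all add: ren_ty_as_sub)
qed

section \<open>Inhabited types\<close>

text \<open>Satisfaction asks only that some term exists, so the calculus of entailments below can
  suppress the witnesses.\<close>

definition inhabited :: "logic \<Rightarrow> ty list \<Rightarrow> ty \<Rightarrow> bool" where
  "inhabited lg \<Gamma> A \<longleftrightarrow> (\<exists>t. has_ty lg \<Gamma> t A)"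

lemma inhabitedI: "has_ty lg \<Gamma> t A \<Longrightarrow> inhabited lg \<Gamma> A"
  by (auto simp: inhabited_def)

lemma inhabited_ren: "inhabited lg \<Gamma> A \<Longrightarrow> renames lg \<Delta> \<rho> \<Gamma> \<Longrightarrow> inhabited lg \<Delta> (ren_ty \<rho> A)"
  unfolding inhabited_def using has_ty_ren by blast

lemma inhabited_lift: "inhabited lg \<Gamma> B \<Longrightarrow> is_ty lg \<Gamma> A \<Longrightarrow> inhabited lg (A # \<Gamma>) (lift_ty B)"
  using inhabited_ren renames_lift by blast

lemma inhabited_hyp: "is_ty lg \<Gamma> A \<Longrightarrow> inhabited lg (A # \<Gamma>) (lift_ty A)"
  using tm_var[OF is_ctx_lift, of lg \<Gamma> A 0] by (auto simp: inhabited_def)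

lemma inhabited_app:
  assumes "inhabited lg \<Gamma> (fun_ty A B)" "inhabited lg \<Gamma> A"
  shows "inhabited lg \<Gamma> B"
proof -
  obtain f a where "has_ty lg \<Gamma> f (PiT A (lift_ty B))" "has_ty lg \<Gamma> a A"
    using assms by (auto simp: inhabited_def fun_ty_def)
  from tm_app[OF this] show ?thesis
    by (simp add: inhabitedI)
qed

text \<open>A deduction theorem: the fresh variable, supplied by \<open>inhabited_hyp\<close>,
  provides the assumption of the second premise, and \<open>tm_lam\<close> abstracts the resulting
  term.\<close>

lemma inhabited_fun:
  assumes "is_ty lg \<Gamma> A"
    and "inhabited lg (A # \<Gamma>) (lift_ty A) \<Longrightarrow> inhabited lg (A # \<Gamma>) (lift_ty B)"
  shows "inhabited lg \<Gamma> (fun_ty A B)"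
  using assms inhabited_hyp[OF assms(1)] tm_lam
  unfolding inhabited_def fun_ty_def by blast

lemma inhabited_pair:
  assumes "is_ty lg \<Gamma> A" "is_ty lg \<Gamma> B" "inhabited lg \<Gamma> A" "inhabited lg \<Gamma> B"
  shows "inhabited lg \<Gamma> (prod_ty A B)"
proof -
  obtain a b where "has_ty lg \<Gamma> a A" "has_ty lg \<Gamma> b B"
    using assms by (auto simp: inhabited_def)
  then show ?thesis
    using tm_pair[OF assms(1) is_ty_lift[OF assms(1,2)], of a b]
    by (auto simp: inhabited_def prod_ty_def)
qed

lemma inhabited_fst: "inhabited lg \<Gamma> (prod_ty A B) \<Longrightarrow> inhabited lg \<Gamma> A"
  unfolding inhabited_def prod_ty_def using tm_fst by blast

lemma inhabited_snd: "inhabited lg \<Gamma> (prod_ty A B) \<Longrightarrow> inhabited lg \<Gamma> B"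
  unfolding inhabited_def prod_ty_def using tm_snd by fastforce

text \<open>Non-dependent elimination: the motive is the weakening of \<open>C\<close>, so both
  branch types collapse to weakenings of \<open>C\<close>. The branches come from applying the
  weakened functions to the new variable.\<close>

lemma inhabited_case:
  assumes "is_ty lg \<Gamma> A" "is_ty lg \<Gamma> B" "is_ty lg \<Gamma> C"
    and "inhabited lg \<Gamma> (SumT A B)" "inhabited lg \<Gamma> (fun_ty A C)" "inhabited lg \<Gamma> (fun_ty B C)"
  shows "inhabited lg \<Gamma> C"
proof -
  have "inhabited lg (A # \<Gamma>) (lift_ty C)" "inhabited lg (B # \<Gamma>) (lift_ty C)"
    using assms by (metis inhabited_app inhabited_hyp inhabited_lift ren_fun_ty)+
  then obtain t d e where t: "has_ty lg \<Gamma> t (SumT A B)"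
    "has_ty lg (A # \<Gamma>) d (lift_ty C)" "has_ty lg (B # \<Gamma>) e (lift_ty C)"
    using assms(4) unfolding inhabited_def by blast
  have "is_ty lg (SumT A B # \<Gamma>) (lift_ty C)"
    using assms is_ty_lift ty_sum by blast
  from tm_case[OF assms(1,2) this t(1), of d e] t(2,3) show ?thesis
    by (simp add: reinst_ty_def ren_ty_as_sub[of Suc] inhabitedI inst_ty_def)
qed

section \<open>Entailment for the propositional connectives\<close>

lemma ent_refl: "is_ty lg \<Gamma> A \<Longrightarrow> inhabited lg \<Gamma> (fun_ty A A)"
  by (rule inhabited_fun)

lemma ent_trans:
  assumes "is_ty lg \<Gamma> A" "inhabited lg \<Gamma> (fun_ty A B)" "inhabited lg \<Gamma> (fun_ty B C)"
  shows "inhabited lg \<Gamma> (fun_ty A C)"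
  using assms(1)
proof (rule inhabited_fun)
  assume "inhabited lg (A # \<Gamma>) (lift_ty A)"
  then show "inhabited lg (A # \<Gamma>) (lift_ty C)"
    using inhabited_lift[OF assms(2,1)] inhabited_lift[OF assms(3,1)] inhabited_app by auto
qed

lemma ent_top: "is_ty lg \<Gamma> A \<Longrightarrow> inhabited lg \<Gamma> (fun_ty A UnitT)"
  by (rule inhabited_fun) (auto intro: inhabitedI tm_star is_ctx_lift)

lemma ent_bot:
  assumes "is_ty lg \<Gamma> A"
  shows "inhabited lg \<Gamma> (fun_ty EmptyT A)"
proof (rule inhabited_fun)
  show e: "is_ty lg \<Gamma> EmptyT"
    using assms ty_empty is_ty_imp_is_ctx by blast
  \<comment> \<open>The motive of \<open>Abort\<close> is lifted twice: once for the hypothesis of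
    type \<open>EmptyT\<close> and once for the variable that the motive binds.\<close>
  then have "is_ty lg (EmptyT # EmptyT # \<Gamma>) (lift_ty (lift_ty A))"
    using assms is_ty_lift[OF is_ty_lift[OF e e] is_ty_lift[OF e assms]] by simp
  then show "inhabited lg (EmptyT # \<Gamma>) (lift_ty A)"
    using tm_abort[of lg "EmptyT # \<Gamma>" "lift_ty (lift_ty A)" "Var 0"] tm_var[OF is_ctx_lift[OF e], of 0]
    by (simp add: inhabitedI del: ren_ren_ty)
qed

lemma ent_and_intro:
  assumes "is_ty lg \<Gamma> A" "is_ty lg \<Gamma> B" "is_ty lg \<Gamma> C"
    and "inhabited lg \<Gamma> (fun_ty C A)" "inhabited lg \<Gamma> (fun_ty C B)"
  shows "inhabited lg \<Gamma> (fun_ty C (prod_ty A B))"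
  using assms(3)
proof (rule inhabited_fun)
  assume "inhabited lg (C # \<Gamma>) (lift_ty C)"
  then have "inhabited lg (C # \<Gamma>) (lift_ty A)" "inhabited lg (C # \<Gamma>) (lift_ty B)"
    using assms(4,5)[THEN inhabited_lift, OF assms(3)] inhabited_app by auto
  then show "inhabited lg (C # \<Gamma>) (lift_ty (prod_ty A B))"
    using assms by (simp add: inhabited_pair is_ty_lift)
qed

lemma ent_fst:
  assumes "is_ty lg \<Gamma> A" "is_ty lg \<Gamma> B"
  shows "inhabited lg \<Gamma> (fun_ty (prod_ty A B) A)"
  using is_ty_prod[OF assms] by (rule inhabited_fun) (auto intro: inhabited_fst)

lemma ent_snd:
  assumes "is_ty lg \<Gamma> A" "is_ty lg \<Gamma> B"
  shows "inhabited lg \<Gamma> (fun_ty (prod_ty A B) B)"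
  using is_ty_prod[OF assms] by (rule inhabited_fun) (auto intro: inhabited_snd)

lemma ent_swap:
  assumes "is_ty lg \<Gamma> A" "is_ty lg \<Gamma> B"
  shows "inhabited lg \<Gamma> (fun_ty (prod_ty A B) (prod_ty B A))"
  using assms by (simp add: ent_and_intro ent_fst ent_snd is_ty_prod)

lemma ent_inl:
  assumes "is_ty lg \<Gamma> A" "is_ty lg \<Gamma> B"
  shows "inhabited lg \<Gamma> (fun_ty A (SumT A B))"
  using assms(1)
  by (rule inhabited_fun) (simp add: inhabited_def, blast intro: tm_inl is_ty_lift assms)

lemma ent_inr:
  assumes "is_ty lg \<Gamma> A" "is_ty lg \<Gamma> B"
  shows "inhabited lg \<Gamma> (fun_ty B (SumT A B))"
  using assms(2)
  by (rule inhabited_fun) (simp add: inhabited_def, blast intro: tm_inr is_ty_lift assms)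

lemma ent_or_elim:
  assumes "is_ty lg \<Gamma> A" "is_ty lg \<Gamma> B" "is_ty lg \<Gamma> C"
    and "inhabited lg \<Gamma> (fun_ty A C)" "inhabited lg \<Gamma> (fun_ty B C)"
  shows "inhabited lg \<Gamma> (fun_ty (SumT A B) C)"
proof (rule inhabited_fun)
  show s: "is_ty lg \<Gamma> (SumT A B)"
    using assms ty_sum by blast
  assume "inhabited lg (SumT A B # \<Gamma>) (lift_ty (SumT A B))"
  then show "inhabited lg (SumT A B # \<Gamma>) (lift_ty C)"
    using inhabited_case[OF is_ty_lift[OF s assms(1)] is_ty_lift[OF s assms(2)] is_ty_lift[OF s assms(3)]]
      assms(4,5)[THEN inhabited_lift, OF s] by simp
qed

lemma ent_uncurry:
  assumes "is_ty lg \<Gamma> A" "is_ty lg \<Gamma> B" "inhabited lg \<Gamma> (fun_ty A (fun_ty B C))"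
  shows "inhabited lg \<Gamma> (fun_ty (prod_ty A B) C)"
proof (rule inhabited_fun)
  show p: "is_ty lg \<Gamma> (prod_ty A B)"
    using assms is_ty_prod by blast
  assume "inhabited lg (prod_ty A B # \<Gamma>) (lift_ty (prod_ty A B))"
  then show "inhabited lg (prod_ty A B # \<Gamma>) (lift_ty C)"
    using inhabited_lift[OF assms(3) p] by (auto dest: inhabited_fst inhabited_snd intro: inhabited_app)
qed

lemma ent_curry:
  assumes "is_ty lg \<Gamma> A" "is_ty lg \<Gamma> B" "inhabited lg \<Gamma> (fun_ty (prod_ty A B) C)"
  shows "inhabited lg \<Gamma> (fun_ty A (fun_ty B C))"
  using assms(1)
proof (rule inhabited_fun)
  note B = is_ty_lift[OF assms(1,2)] and A = is_ty_lift[OF assms(1,1)]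
  have "inhabited lg (A # \<Gamma>) (fun_ty (lift_ty B) (lift_ty C))"
    using B
  proof (rule inhabited_fun)
    assume "inhabited lg (lift_ty B # A # \<Gamma>) (lift_ty (lift_ty B))"
    moreover have "inhabited lg (lift_ty B # A # \<Gamma>) (lift_ty (lift_ty A))"
      using inhabited_lift[OF inhabited_hyp[OF assms(1)] B] .
    ultimately have "inhabited lg (lift_ty B # A # \<Gamma>) (lift_ty (lift_ty (prod_ty A B)))"
      using inhabited_pair[OF is_ty_lift[OF B A] is_ty_lift[OF B B]] by simp
    moreover have "inhabited lg (lift_ty B # A # \<Gamma>) (lift_ty (lift_ty (fun_ty (prod_ty A B) C)))"
      using inhabited_lift[OF inhabited_lift[OF assms(3,1)] B] .
    ultimately show "inhabited lg (lift_ty B # A # \<Gamma>) (lift_ty (lift_ty C))"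
      by (auto intro: inhabited_app)
  qed
  then show "inhabited lg (A # \<Gamma>) (lift_ty (fun_ty B C))"
    by simp
qed

text \<open>Function types make this derivable: once \<open>A\<close> is swapped to the right and
  curried away, the claim is a plain elimination of the sum with target
  \<open>fun_ty A ?D\<close>.\<close>

lemma ent_distributivity:
  assumes "is_ty lg \<Gamma> A" "is_ty lg \<Gamma> B" "is_ty lg \<Gamma> C"
  shows "inhabited lg \<Gamma> (fun_ty (prod_ty A (SumT B C)) (SumT (prod_ty A B) (prod_ty A C)))"
    (is "inhabited lg \<Gamma> (fun_ty _ ?D)")
proof -
  note t = assms is_ty_prod is_ty_fun ty_sum
  have "inhabited lg \<Gamma> (fun_ty B (fun_ty A ?D))" "inhabited lg \<Gamma> (fun_ty C (fun_ty A ?D))"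
    by (rule ent_curry, simp_all add: t, rule ent_trans[OF _ ent_swap], simp_all add: t ent_inl ent_inr)+
  then have "inhabited lg \<Gamma> (fun_ty (prod_ty (SumT B C) A) ?D)"
    by (intro ent_uncurry ent_or_elim) (simp_all add: t)
  from ent_trans[OF _ ent_swap this] show ?thesis
    by (simp add: t)
qed

section \<open>Entailment for the quantifiers\<close>

lemma ent_ex_elim:
  assumes "is_ty lg \<Gamma> S" "is_ty lg (S # \<Gamma>) A" "inhabited lg (S # \<Gamma>) (fun_ty A (lift_ty B))"
  shows "inhabited lg \<Gamma> (fun_ty (SigT S A) B)"
proof (rule inhabited_fun)
  let ?\<Delta> = "SigT S A # \<Gamma>"
  show s: "is_ty lg \<Gamma> (SigT S A)"
    using assms ty_sig by blast
  \<comment> \<open>The hypothesis is a pair. The given entailment, weakened to this context, is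
    instantiated at its first projection and then applied to its second.\<close>
  have p: "has_ty lg ?\<Delta> (Var 0) (SigT (lift_ty S) (ren_ty (up Suc) A))"
    using tm_var[OF is_ctx_lift[OF s], of 0] by simp
  have "inhabited lg (lift_ty S # ?\<Delta>) (fun_ty (ren_ty (up Suc) A) (lift_ty (lift_ty B)))"
    using inhabited_ren[OF assms(3) renames_up[OF renames_lift is_ty_lift], OF s s assms(1)] by simp
  then obtain t where t: "has_ty lg (lift_ty S # ?\<Delta>) t (fun_ty (ren_ty (up Suc) A) (lift_ty (lift_ty B)))"
    by (auto simp: inhabited_def)
  have "inhabited lg ?\<Delta> (fun_ty (inst_ty (ren_ty (up Suc) A) (Fst (Var 0))) (lift_ty B))"
    using has_ty_sub[OF t substitutes_inst[OF tm_fst[OF p]]]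
    by (auto simp: inst_ty_def ren_ty_as_sub[of Suc] inhabited_def)
  then show "inhabited lg ?\<Delta> (lift_ty B)"
    using tm_snd[OF p] inhabited_app inhabitedI by blast
qed

text \<open>When a quantifier is opened, the variable for its sort lies just behind one hypothesis,
  hence has index 1. Weakening the body past both entries under its binder and instantiating at that
  variable leaves only the weakening past the hypothesis.\<close>

lemma inst_Var_1: "inst_ty (ren_ty (up (\<lambda>i. Suc (Suc i))) A) (Var (Suc 0)) = lift_ty A"
  unfolding inst_ty_def ren_ty_as_sub[of Suc]
  by (simp, rule sub_ty_cong_nat) simp_all

lemma ent_ex_intro:
  assumes "is_ty lg \<Gamma> S" "is_ty lg (S # \<Gamma>) A" "inhabited lg \<Gamma> (fun_ty (SigT S A) B)"
  shows "inhabited lg (S # \<Gamma>) (fun_ty A (lift_ty B))"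
  using assms(2)
proof (rule inhabited_fun)
  let ?\<Delta> = "A # S # \<Gamma>"
  have S: "is_ty lg ?\<Delta> (ren_ty (\<lambda>i. Suc (Suc i)) S)"
    using is_ty_lift[OF assms(2) is_ty_lift[OF assms(1,1)]] by simp
  have r: "renames lg ?\<Delta> (\<lambda>i. Suc (Suc i)) \<Gamma>"
    using assms by (auto simp: renames_def intro: is_ctx_lift)
  \<comment> \<open>The witness is the declared element of \<open>S\<close>, at index 1, paired with
    the hypothesis \<open>A\<close> about it, at index 0.\<close>
  have "has_ty lg ?\<Delta> (Pr (Var 1) (Var 0)) (ren_ty (\<lambda>i. Suc (Suc i)) (SigT S A))"
    using tm_pair[OF S is_ty_ren[OF assms(2) renames_up[OF r S]], of "Var 1" "Var 0"]
      tm_var[OF is_ctx_lift[OF assms(2)], of 0] tm_var[OF is_ctx_lift[OF assms(2)], of 1]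
    by (simp add: inst_Var_1)
  moreover have "inhabited lg ?\<Delta> (ren_ty (\<lambda>i. Suc (Suc i)) (fun_ty (SigT S A) B))"
    using inhabited_ren[OF assms(3) r] .
  ultimately show "inhabited lg ?\<Delta> (lift_ty (lift_ty B))"
    using inhabited_app inhabitedI by fastforce
qed

text \<open>Open the existential, send its body to \<open>UnitT\<close>, and reintroduce it; the
  introduction is \<open>ent_ex_intro\<close> applied to a reflexive entailment.\<close>

lemma ent_ex_top:
  assumes "is_ty lg \<Gamma> S" "is_ty lg (S # \<Gamma>) A"
  shows "inhabited lg \<Gamma> (fun_ty (SigT S A) (SigT S UnitT))"
proof -
  have u: "is_ty lg (S # \<Gamma>) UnitT"
    using assms(2) is_ty_imp_is_ctx ty_unit by blast
  have "inhabited lg (S # \<Gamma>) (fun_ty UnitT (lift_ty (SigT S UnitT)))"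
    using ent_ex_intro[OF assms(1) u ent_refl[OF ty_sig[OF assms(1) u]]] .
  from ent_ex_elim[OF assms ent_trans[OF assms(2) ent_top[OF assms(2)] this]] show ?thesis .
qed

text \<open>As for distributivity, currying moves \<open>A\<close> into the target. The target
  \<open>fun_ty A ?C\<close> lives over \<Gamma> and appears lifted under \<open>S\<close>, which is
  the form that \<open>ent_ex_elim\<close> requires.\<close>

lemma ent_frobenius:
  assumes "is_ty lg \<Gamma> A" "is_ty lg \<Gamma> S" "is_ty lg (S # \<Gamma>) B"
  shows "inhabited lg \<Gamma> (fun_ty (prod_ty A (SigT S B)) (SigT S (prod_ty (lift_ty A) B)))"
    (is "inhabited lg \<Gamma> (fun_ty _ ?C)")
proof -
  note A = is_ty_lift[OF assms(2,1)]
  have ex: "is_ty lg \<Gamma> (SigT S B)" "is_ty lg \<Gamma> ?C"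
    using assms A by (auto intro: ty_sig is_ty_prod)
  have "inhabited lg (S # \<Gamma>) (fun_ty (prod_ty (lift_ty A) B) (lift_ty ?C))"
    using ent_ex_intro[OF assms(2) is_ty_prod[OF A assms(3)] ent_refl[OF ex(2)]] .
  from ent_trans[OF is_ty_prod ent_swap this] have "inhabited lg (S # \<Gamma>) (fun_ty B (lift_ty (fun_ty A ?C)))"
    using ent_curry[OF assms(3) A] A assms(3) by simp
  then have "inhabited lg \<Gamma> (fun_ty (prod_ty (SigT S B) A) ?C)"
    using ent_uncurry ent_ex_elim assms ex(1) by blast
  from ent_trans[OF is_ty_prod ent_swap this] show ?thesis
    using assms ex by blast
qed

lemma ent_all_intro:
  assumes "is_ty lg \<Gamma> C" "is_ty lg \<Gamma> S" "inhabited lg (S # \<Gamma>) (fun_ty (lift_ty C) A)"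
  shows "inhabited lg \<Gamma> (fun_ty C (PiT S A))"
  using assms(1)
proof (rule inhabited_fun)
  note S = is_ty_lift[OF assms(1,2)]
  have "inhabited lg (lift_ty S # C # \<Gamma>) (ren_ty (up Suc) (fun_ty (lift_ty C) A))"
    using inhabited_ren[OF assms(3) renames_up[OF renames_lift]] assms(1) S by blast
  moreover have "inhabited lg (lift_ty S # C # \<Gamma>) (lift_ty (lift_ty C))"
    using inhabited_lift[OF inhabited_hyp] assms(1) S by blast
  ultimately have "inhabited lg (lift_ty S # C # \<Gamma>) (ren_ty (up Suc) A)"
    by (auto intro: inhabited_app)
  then show "inhabited lg (C # \<Gamma>) (lift_ty (PiT S A))"
    using tm_lam[OF S] by (auto simp: inhabited_def)
qed

lemma ent_all_elim:
  assumes "is_ty lg \<Gamma> C" "is_ty lg \<Gamma> S" "inhabited lg \<Gamma> (fun_ty C (PiT S A))"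
  shows "inhabited lg (S # \<Gamma>) (fun_ty (lift_ty C) A)"
proof (rule inhabited_fun)
  let ?\<Delta> = "lift_ty C # S # \<Gamma>"
  show C: "is_ty lg (S # \<Gamma>) (lift_ty C)"
    using is_ty_lift[OF assms(2,1)] .
  assume "inhabited lg ?\<Delta> (lift_ty (lift_ty C))"
  moreover have "inhabited lg ?\<Delta> (lift_ty (lift_ty (fun_ty C (PiT S A))))"
    using inhabited_lift[OF inhabited_lift[OF assms(3,2)] C] .
  ultimately have "inhabited lg ?\<Delta> (lift_ty (lift_ty (PiT S A)))"
    by (auto intro: inhabited_app)
  then obtain t where "has_ty lg ?\<Delta> t (PiT (ren_ty (\<lambda>i. Suc (Suc i)) S) (ren_ty (up (\<lambda>i. Suc (Suc i))) A))"
    by (auto simp: inhabited_def up_comp)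
  from tm_app[OF this, of "Var 1"] show "inhabited lg ?\<Delta> (lift_ty A)"
    using tm_var[OF is_ctx_lift[OF C], of 1] by (simp add: inst_Var_1 inhabitedI)
qed

text \<open>Connects the closed product type in \<open>satisfies\<close> with a judgement over the
  open context. A function is opened by weakening it and applying it to variable 0, which undoes the
  lifting of its body; the converse is abstraction.\<close>

lemma inhabited_pis_iff:
  "is_ctx lg \<Gamma> \<Longrightarrow> inhabited lg [] (pis \<Gamma> B) \<longleftrightarrow> inhabited lg \<Gamma> B"
proof (induction \<Gamma> arbitrary: B)
  case (Cons A \<Gamma>)
  then have A: "is_ctx lg \<Gamma>" "is_ty lg \<Gamma> A"
    using is_ctx_ConsD by blast+
  have "inhabited lg \<Gamma> (PiT A B) \<longleftrightarrow> inhabited lg (A # \<Gamma>) B"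
  proof
    assume "inhabited lg \<Gamma> (PiT A B)"
    from inhabited_lift[OF this A(2)] obtain t
      where "has_ty lg (A # \<Gamma>) t (PiT (lift_ty A) (ren_ty (up Suc) B))"
      by (auto simp: inhabited_def)
    moreover have "has_ty lg (A # \<Gamma>) (Var 0) (lift_ty A)"
      using tm_var[OF Cons.prems, of 0] by simp
    moreover have "inst_ty (ren_ty (up Suc) B) (Var 0) = B"
      using sub_ty_cong_nat[of "\<lambda>i. case_nat (Var 0) Var (up Suc i)" Var B] by (simp add: inst_ty_def)
    ultimately show "inhabited lg (A # \<Gamma>) B"
      using tm_app inhabitedI by fastforce
  next
    assume "inhabited lg (A # \<Gamma>) B"
    then show "inhabited lg \<Gamma> (PiT A B)"
      unfolding inhabited_def using tm_lam A(2) by blast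
  qed
  then show ?case
    using Cons.IH A(1) by simp
qed simp

section \<open>Components of a structure\<close>

lemma nth_pos: "x \<in> set xs \<Longrightarrow> xs ! pos x xs = x"
  by (induction xs) auto

lemma pos_less_length: "x \<in> set xs \<Longrightarrow> pos x xs < length xs"
  by (induction xs) auto

lemma pos_nth: "distinct xs \<Longrightarrow> i < length xs \<Longrightarrow> pos (xs ! i) xs = i"
  by (induction xs arbitrary: i) (auto simp: nth_Cons split: nat.split)

lemma map_nth_pos: "distinct xs \<Longrightarrow> length ys = length xs \<Longrightarrow> map (\<lambda>x. ys ! pos x xs) xs = ys"
  by (rule nth_equalityI) (simp_all add: pos_nth)

lemma arrows_from_conv:
  assumes "folds_signature L" "K \<in> Obj L"
  shows "set (arrows_from L K) = nonid_from L K" "distinct (arrows_from L K)"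
    "sorted_wrt (\<lambda>f g. \<not> arr_less L g f) (arrows_from L K)"
  using assms unfolding folds_signature_def increasing_listing_def by blast+

lemma folds_signatureD:
  assumes "folds_signature L"
  shows "f \<in> Arr L \<Longrightarrow> Cod L f \<in> Obj L"
    and "K \<in> Obj L \<Longrightarrow> Cod L (Id L K) = K"
    and "f \<in> Arr L \<Longrightarrow> g \<in> Arr L \<Longrightarrow> Dom L g = Cod L f \<Longrightarrow>
      Comp L g f \<in> Arr L \<and> Dom L (Comp L g f) = Dom L f \<and> Cod L (Comp L g f) = Cod L g"
    and "K \<in> Obj L \<Longrightarrow> \<not> obj_less L K K"
    and "I \<in> Obj L \<Longrightarrow> J \<in> Obj L \<Longrightarrow> K \<in> Obj L \<Longrightarrow> obj_less L I J \<Longrightarrow> obj_less L J K \<Longrightarrow> obj_less L I K"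
    and "K \<in> Obj L \<Longrightarrow> f \<in> nonid_from L K \<Longrightarrow> obj_less L (Cod L f) K"
    and "f \<in> Arr L \<Longrightarrow> g \<in> Arr L \<Longrightarrow> obj_less L (Cod L f) (Cod L g) \<Longrightarrow> arr_less L f g"
proof -
  have "category L" "proper_order L"
    using assms unfolding folds_signature_def inverse_category_def by blast+
  note c = this(1)[unfolded category_def] and o = this(2)[unfolded proper_order_def]
  show "f \<in> Arr L \<Longrightarrow> Cod L f \<in> Obj L" "K \<in> Obj L \<Longrightarrow> Cod L (Id L K) = K"
    "f \<in> Arr L \<Longrightarrow> g \<in> Arr L \<Longrightarrow> Dom L g = Cod L f \<Longrightarrow>
      Comp L g f \<in> Arr L \<and> Dom L (Comp L g f) = Dom L f \<and> Cod L (Comp L g f) = Cod L g"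
    using c by blast+
  show "K \<in> Obj L \<Longrightarrow> \<not> obj_less L K K"
    "K \<in> Obj L \<Longrightarrow> f \<in> nonid_from L K \<Longrightarrow> obj_less L (Cod L f) K"
    "f \<in> Arr L \<Longrightarrow> g \<in> Arr L \<Longrightarrow> obj_less L (Cod L f) (Cod L g) \<Longrightarrow> arr_less L f g"
    using o irreflp_onD by metis+
  show "I \<in> Obj L \<Longrightarrow> J \<in> Obj L \<Longrightarrow> K \<in> Obj L \<Longrightarrow> obj_less L I J \<Longrightarrow> obj_less L J K \<Longrightarrow> obj_less L I K"
    using o transp_onD by metis
qed

lemma nonid_from_cod:
  assumes "folds_signature L" "K \<in> Obj L" "f \<in> nonid_from L K"
  shows "Cod L f \<in> Obj L" "obj_less L (Cod L f) K"
  using assms(3) folds_signatureD(1,6)[OF assms(1)] assms(2) unfolding nonid_from_def by blast+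

text \<open>All three claims are read off codomains: the composite has the codomain of
  \<open>p\<close>, which lies strictly below that of \<open>f\<close> and hence strictly below
  \<open>K\<close>.\<close>

lemma nonid_from_comp:
  assumes L: "folds_signature L" and K: "K \<in> Obj L"
    and f: "f \<in> nonid_from L K" and p: "p \<in> nonid_from L (Cod L f)"
  shows "Comp L p f \<in> nonid_from L K" "arr_less L (Comp L p f) f" "Comp L p f \<noteq> f"
proof -
  have fp: "f \<in> Arr L" "p \<in> Arr L" "Dom L p = Cod L f" "Dom L f = K"
    using f p by (simp_all add: nonid_from_def)
  then have c: "Comp L p f \<in> Arr L" "Dom L (Comp L p f) = K" "Cod L (Comp L p f) = Cod L p"
    using folds_signatureD(3)[OF L] by simp_all
  note o = nonid_from_cod[OF L K f]
  note q = nonid_from_cod[OF L o(1) p]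
  have "obj_less L (Cod L p) K"
    using folds_signatureD(5)[OF L q(1) o(1) K q(2) o(2)] .
  then show "Comp L p f \<in> nonid_from L K"
    using c folds_signatureD(2,4)[OF L K] by (auto simp: nonid_from_def)
  show "arr_less L (Comp L p f) f"
    using folds_signatureD(7)[OF L c(1) fp(1)] c(3) q(2) by simp
  show "Comp L p f \<noteq> f"
    using c(3) q(2) folds_signatureD(4)[OF L o(1)] by auto
qed

text \<open>The composite occurs in the listing, differs from \<open>f\<close>, and is below
  \<open>f\<close>; an increasing listing puts nothing below \<open>f\<close> after it. Thus the
  arguments that the type of the argument at \<open>f\<close> mentions are already bound.\<close>

lemma comp_listed_before:
  assumes "folds_signature L" "K \<in> Obj L" "arrows_from L K = pre @ f # post"
    and "p \<in> set (arrows_from L (Cod L f))"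
  shows "Comp L p f \<in> set pre"
proof -
  note fs = arrows_from_conv[OF assms(1,2), unfolded assms(3)]
  have f: "f \<in> nonid_from L K"
    unfolding fs(1)[symmetric] by simp
  have p: "p \<in> nonid_from L (Cod L f)"
    using arrows_from_conv(1)[OF assms(1) nonid_from_cod(1)[OF assms(1,2) f]] assms(4) by simp
  note c = nonid_from_comp[OF assms(1,2) f p]
  have "Comp L p f \<in> set (pre @ f # post)"
    unfolding fs(1) by (rule c(1))
  moreover have "\<forall>g\<in>set post. \<not> arr_less L g f"
    using fs(3) by (simp add: sorted_wrt_append)
  ultimately show ?thesis
    using c(2,3) by auto
qed

text \<open>The same argument one level up: a component's type mentions only components listed
  earlier.\<close>

lemma cod_listed_before:
  assumes "folds_signature L" "increasing_listing (obj_less L) (Obj L) (pre @ K # post)"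
    and "f \<in> set (arrows_from L K)"
  shows "Cod L f \<in> set pre"
proof -
  have o: "set (pre @ K # post) = Obj L" "\<forall>J\<in>set post. \<not> obj_less L J K"
    using assms(2) by (simp_all add: increasing_listing_def sorted_wrt_append)
  have K: "K \<in> Obj L"
    unfolding o(1)[symmetric] by simp
  have "f \<in> nonid_from L K"
    using assms(3) arrows_from_conv(1)[OF assms(1) K] by simp
  note c = nonid_from_cod[OF assms(1) K this]
  have "Cod L f \<in> set (pre @ K # post)"
    unfolding o(1) by (rule c(1))
  then show ?thesis
    using o(2) c(2) folds_signatureD(4)[OF assms(1) K] by auto
qed

section \<open>Typing of components and their iterated applications\<close>

lemma sub_foldl_App: "sub_tm \<sigma> (foldl App t us) = foldl App (sub_tm \<sigma> t) (map (sub_tm \<sigma>) us)"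
  by (induction us arbitrary: t) simp_all

lemma sub_iapp: "sub_tm \<sigma> (iapp t us) = iapp (sub_tm \<sigma> t) (map (sub_tm \<sigma>) us)"
  by (simp add: iapp_def sub_foldl_App)

lemma sub_component: "sub_tm \<sigma> (component Ks M K) = component Ks (sub_tm \<sigma> M) K"
  by (induction Ks M K rule: component.induct) auto

lemma ren_ren_sort [simp]: "ren_sort \<rho> (ren_sort \<rho>' S) = ren_sort (\<lambda>i. \<rho> (\<rho>' i)) S"
  by (cases S) simp

text \<open>Induction along the remaining arrows \<open>fs\<close>, with \<sigma> recording what has
  been supplied so far: first the arguments for \<open>gs\<close>, most recent first, then the
  components for \<open>Js\<close>. The second and third assumptions guarantee that every position
  looked up in these lists is a genuine one.\<close>

lemma arrows_ty_app:
  assumes "has_ty lg \<Gamma> t (sub_ty \<sigma> (arrows_ty L Js gs fs))"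
    and "\<And>f. f \<in> set fs \<Longrightarrow> Cod L f \<in> set Js"
    and "\<And>pre f post p. fs = pre @ f # post \<Longrightarrow> p \<in> set (arrows_from L (Cod L f)) \<Longrightarrow>
      Comp L p f \<in> set gs \<union> set pre"
    and "\<And>i. i < length Js \<Longrightarrow> \<sigma> (length gs + i) = c (Js ! i)"
    and "\<And>i. i < length gs \<Longrightarrow> \<sigma> i = Var (x (gs ! i))"
    and "\<And>f. f \<in> set fs \<Longrightarrow> has_ty lg \<Gamma> (Var (x f))
      (El (iapp (c (Cod L f)) (map (\<lambda>p. Var (x (Comp L p f))) (arrows_from L (Cod L f)))))"
  shows "has_ty lg \<Gamma> (foldl App t (map (\<lambda>f. Var (x f)) fs)) Univ"
  using assms
proof (induction fs arbitrary: t gs \<sigma>)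
  case (Cons f fs)
  have comp: "Comp L p f \<in> set gs" if "p \<in> set (arrows_from L (Cod L f))" for p
    using Cons.prems(3)[of "[]" f fs p] that by simp
  have args: "map (\<lambda>p. \<sigma> (pos (Comp L p f) gs)) (arrows_from L (Cod L f)) =
      map (\<lambda>p. Var (x (Comp L p f))) (arrows_from L (Cod L f))"
    using comp Cons.prems(5) by (auto simp: nth_pos pos_less_length)
  have head: "\<sigma> (length gs + pos (Cod L f) Js) = c (Cod L f)"
    using Cons.prems(2,4) by (simp add: nth_pos pos_less_length)
  have "has_ty lg \<Gamma> t (PiT (El (iapp (c (Cod L f)) (map (\<lambda>p. Var (x (Comp L p f))) (arrows_from L (Cod L f)))))
      (sub_ty (ups \<sigma>) (arrows_ty L Js (f # gs) fs)))"
    using Cons.prems(1) by (simp add: sub_iapp o_def args head)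
  \<comment> \<open>The new argument becomes entry 0 of the substitution, matching the move of
    \<open>f\<close> to the front of \<open>gs\<close>.\<close>
  from tm_app[OF this Cons.prems(6)]
  have "has_ty lg \<Gamma> (App t (Var (x f))) (sub_ty (case_nat (Var (x f)) \<sigma>) (arrows_ty L Js (f # gs) fs))"
    by (simp add: inst_sub_ups_ty)
  then have "has_ty lg \<Gamma> (foldl App (App t (Var (x f))) (map (\<lambda>f. Var (x f)) fs)) Univ"
  proof (rule Cons.IH)
    show "Comp L p g \<in> set (f # gs) \<union> set pre"
      if "fs = pre @ g # post" "p \<in> set (arrows_from L (Cod L g))" for pre g post p
      using Cons.prems(3)[of "f # pre" g post p] that by auto
    show "case_nat (Var (x f)) \<sigma> i = Var (x ((f # gs) ! i))" if "i < length (f # gs)" for i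
      using that Cons.prems(5) by (cases i) auto
  qed (use Cons.prems in auto)
  then show ?case
    by simp
qed simp

text \<open>Peels the nested sum from the front. \<open>N\<close> is the tail still to be projected,
  while \<open>c\<close> fixes the components of the original term, which the recursion on tails
  would otherwise lose sight of. Objects passed over accumulate most recent first, whence
  \<open>rev pre @ Js\<close>.\<close>

lemma has_ty_component_from:
  assumes "has_ty lg [] N (sub_ty (\<lambda>i. c (Js ! i)) (struc_from L Js Ks))"
    and "distinct Ks" "\<And>K. K \<in> set Ks \<Longrightarrow> component Ks N K = c K"
    and "Ks = pre @ K # post"
  shows "has_ty lg [] (c K) (sub_ty (\<lambda>i. c ((rev pre @ Js) ! i)) (obj_ty L (rev pre @ Js) K))"
  using assms
proof (induction L Js Ks arbitrary: N pre rule: struc_from.induct)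
  case (2 L Js J)
  then show ?case
    by (cases pre) auto
next
  case (3 L Js J J' Ks)
  have fst: "c J = Fst N"
    using "3.prems"(3)[of J] by simp
  show ?case
  proof (cases pre)
    case Nil
    then show ?thesis
      using 3 fst tm_fst by fastforce
  next
    case (Cons J0 pre')
    then have pre: "pre = J # pre'" "J' # Ks = pre' @ K # post"
      using "3.prems"(4) by auto
    \<comment> \<open>The first projection is \<open>c J\<close>, so instantiating with it turns the
      substitution for \<open>Js\<close> into the one for \<open>J # Js\<close>.\<close>
    have "sub_ty (case_nat (Fst N) (\<lambda>i. c (Js ! i))) (struc_from L (J # Js) (J' # Ks)) =
        sub_ty (\<lambda>i. c ((J # Js) ! i)) (struc_from L (J # Js) (J' # Ks))"
      by (rule sub_ty_cong_nat) (simp_all add: fst)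
    moreover have "has_ty lg [] (Snd N)
        (inst_ty (sub_ty (ups (\<lambda>i. c (Js ! i))) (struc_from L (J # Js) (J' # Ks))) (Fst N))"
      using "3.prems"(1) tm_snd by simp
    ultimately have "has_ty lg [] (Snd N) (sub_ty (\<lambda>i. c ((J # Js) ! i)) (struc_from L (J # Js) (J' # Ks)))"
      by (simp add: inst_sub_ups_ty)
    moreover have "component (J' # Ks) (Snd N) I = c I" if "I \<in> set (J' # Ks)" for I
    proof -
      have "I \<noteq> J"
        using that "3.prems"(2) by auto
      then show ?thesis
        using "3.prems"(3)[of I] that by simp
    qed
    ultimately show ?thesis
      using "3.IH"[of "Snd N" pre'] "3.prems"(2) pre by simp
  qed
qed simp

section \<open>Interpretations in a structure\<close>

locale folds_structure =
  fixes lg :: logic and L :: "('o, 'a) signature" and Ks :: "'o list" and M :: tm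
  assumes signature: "folds_signature L"
    and listing: "increasing_listing (obj_less L) (Obj L) Ks"
    and structure_M: "is_structure lg L Ks M"
begin

lemma sub_M [simp]: "sub_tm \<sigma> (component Ks M K) = component Ks M K"
  using structure_M has_ty_sub_id[of lg "[]" M _ \<sigma>] by (simp add: is_structure_def sub_component)

lemma ren_sort_int [simp]: "ren_ty \<rho> (sort_int Ks M S) = sort_int Ks M (ren_sort \<rho> S)"
  by (cases S) (simp add: ren_tm_as_sub sub_iapp o_def)

lemma ren_form_int [simp]: "ren_ty \<rho> (form_int Ks M \<phi>) = form_int Ks M (ren_form \<rho> \<phi>)"
  by (induction \<phi> arbitrary: \<rho>) simp_all

lemma has_ty_component:
  assumes "Ks = pre @ K # post" "is_ctx lg \<Gamma>"
  shows "has_ty lg \<Gamma> (component Ks M K)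
    (sub_ty (\<lambda>i. component Ks M (rev pre ! i)) (obj_ty L (rev pre) K))"
proof -
  have "has_ty lg [] M (Struc L Ks)"
    using structure_M by (simp add: is_structure_def)
  \<comment> \<open>Any \<sigma> is a substitution from the empty context to itself, and
    \<open>M\<close> is fixed by it. This gives the initial form needed for peeling without
    computing the substitution on \<open>Struc\<close>.\<close>
  then have "has_ty lg [] M (sub_ty \<sigma> (Struc L Ks))" for \<sigma>
    using has_ty_sub[of lg "[]" M "Struc L Ks" "[]" \<sigma>] has_ty_sub_id[of lg "[]" M _ \<sigma>] ctx_nil
    by (simp add: substitutes_def)
  then have "has_ty lg [] (component Ks M K)
      (sub_ty (\<lambda>i. component Ks M ((rev pre @ []) ! i)) (obj_ty L (rev pre @ []) K))"
    using listing assms(1) unfolding Struc_def increasing_listing_def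
    by (intro has_ty_component_from[where c = "component Ks M"]) auto
  \<comment> \<open>The identity substitution serves as weakening from the empty context to
    \<Gamma>.\<close>
  from has_ty_sub[OF this, of \<Gamma> Var] show ?thesis
    using assms(2) by (simp add: substitutes_def)
qed

lemma has_ty_declared:
  assumes "is_ctx lg (context_int Ks M \<Gamma>)" "declared \<Gamma> i S"
  shows "has_ty lg (context_int Ks M \<Gamma>) (Var i) (sort_int Ks M S)"
  using assms tm_var[OF assms(1), of i] by (simp add: declared_def context_int_def)

text \<open>The argument sorts demanded by \<open>sort_in\<close> are interpreted exactly by the
  argument types in the type of the component, so the component can be applied to all its
  arguments.\<close>

lemma has_ty_sort_code:
  assumes ctx: "is_ctx lg (context_int Ks M \<Gamma>)" and sort: "sort_in L \<Gamma> (Sort K xs)"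
  shows "has_ty lg (context_int Ks M \<Gamma>) (iapp (component Ks M K) (map Var xs)) Univ"
proof -
  let ?fs = "arrows_from L K" and ?\<Gamma> = "context_int Ks M \<Gamma>"
  have K: "K \<in> Obj L" and len: "length xs = length ?fs"
    using sort by auto
  note fs = arrows_from_conv[OF signature K]
  obtain pre post where Ks: "Ks = pre @ K # post"
    using K listing split_list[of K Ks] unfolding increasing_listing_def by blast
  note c = has_ty_component[OF Ks ctx]
  show ?thesis
  proof (cases "?fs = []")
    case True
    then have "has_ty lg ?\<Gamma> (component Ks M K) (PiT UnitT Univ)"
      using c by (simp add: obj_ty_def fun_ty_def)
    from tm_app[OF this tm_star[OF ctx]] show ?thesis
      using True len by (simp add: iapp_def inst_ty_def)
  next
    case False
    \<comment> \<open>Passes from the tuple as a list to the tuple as a function of arrows;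
      \<open>xs\<close> is recovered because the listing has no repetitions.\<close>
    define x where "x f = xs ! pos f ?fs" for f
    have xs: "map x ?fs = xs"
      unfolding x_def using map_nth_pos[OF fs(2) len] .
    have "has_ty lg ?\<Gamma> (foldl App (component Ks M K) (map (\<lambda>f. Var (x f)) ?fs)) Univ"
    proof (rule arrows_ty_app[where gs = "[]" and c = "component Ks M"])
      show "has_ty lg ?\<Gamma> (component Ks M K)
          (sub_ty (\<lambda>i. component Ks M (rev pre ! i)) (arrows_ty L (rev pre) [] ?fs))"
        using c False by (simp add: obj_ty_def)
      show "Cod L f \<in> set (rev pre)" if "f \<in> set ?fs" for f
        using cod_listed_before[OF signature listing[unfolded Ks] that] by simp
      show "Comp L p f \<in> set [] \<union> set pre'"
        if "?fs = pre' @ f # post'" "p \<in> set (arrows_from L (Cod L f))" for pre' f post' p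
        using comp_listed_before[OF signature K that] by simp
      show "has_ty lg ?\<Gamma> (Var (x f)) (El (iapp (component Ks M (Cod L f))
          (map (\<lambda>p. Var (x (Comp L p f))) (arrows_from L (Cod L f)))))" if "f \<in> set ?fs" for f
      proof -
        have "declared \<Gamma> (x f) (arg_sort L K xs f)"
          using sort that fs(1) by (simp add: x_def)
        from has_ty_declared[OF ctx this] show ?thesis
          by (simp add: arg_sort_def x_def o_def)
      qed
    qed simp_all
    moreover have "map (\<lambda>f. Var (x f)) ?fs = map Var xs"
      unfolding xs[symmetric] by simp
    moreover have "xs \<noteq> []"
      using False len by auto
    ultimately show ?thesis
      by (simp add: iapp_def)
  qed
qed

lemma is_ty_sort:
  "is_ctx lg (context_int Ks M \<Gamma>) \<Longrightarrow> sort_in L \<Gamma> S \<Longrightarrow> is_ty lg (context_int Ks M \<Gamma>) (sort_int Ks M S)"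
  by (cases S) (auto intro: ty_el has_ty_sort_code simp del: sort_in.simps)

lemma is_ctx_context_int: "wf_context L \<Gamma> \<Longrightarrow> is_ctx lg (context_int Ks M \<Gamma>)"
  by (induction \<Gamma>) (simp_all add: context_int_def ctx_nil, metis context_int_def ctx_cons is_ty_sort)

lemma context_int_Cons: "context_int Ks M (S # \<Gamma>) = sort_int Ks M S # context_int Ks M \<Gamma>"
  by (simp add: context_int_def)

lemma is_ty_form:
  "wf_context L \<Gamma> \<Longrightarrow> form_in L \<Gamma> \<phi> \<Longrightarrow> is_ty lg (context_int Ks M \<Gamma>) (form_int Ks M \<phi>)"
proof (induction \<phi> arbitrary: \<Gamma>)
  case (Forall S \<phi>)
  then show ?case
    using Forall.IH[of "S # \<Gamma>"] by (auto simp: context_int_Cons intro: ty_pi is_ty_sort is_ctx_context_int)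
next
  case (Exists S \<phi>)
  then show ?case
    using Exists.IH[of "S # \<Gamma>"] by (auto simp: context_int_Cons intro: ty_sig is_ty_sort is_ctx_context_int)
qed (auto intro: ty_empty ty_unit is_ctx_context_int is_ty_prod is_ty_fun ty_sum)

text \<open>\<open>Lem\<close> quantifies over the universe, so a formula needs a code there. One
  exists because the universe is closed under all the formers used, but it decodes to the
  interpretation only up to judgemental equality.\<close>

lemma form_code:
  assumes "wf_context L \<Gamma>" "form_in L \<Gamma> \<phi>"
  shows "\<exists>a. has_ty lg (context_int Ks M \<Gamma>) a Univ \<and>
    eq_ty lg (context_int Ks M \<Gamma>) (El a) (form_int Ks M \<phi>)"
  using assms
proof (induction \<phi> arbitrary: \<Gamma>)
  case Bot
  then show ?case
    using tm_cempty el_empty is_ctx_context_int by fastforce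
next
  case Top
  then show ?case
    using tm_cunit el_unit is_ctx_context_int by fastforce
next
  case (And \<phi> \<psi>)
  let ?\<Gamma> = "context_int Ks M \<Gamma>"
  obtain a b where a: "has_ty lg ?\<Gamma> a Univ" "eq_ty lg ?\<Gamma> (El a) (form_int Ks M \<phi>)"
    and b: "has_ty lg ?\<Gamma> b Univ" "eq_ty lg ?\<Gamma> (El b) (form_int Ks M \<psi>)"
    using And by fastforce
  \<comment> \<open>\<open>CSig\<close> binds a variable even for a plain product, so the second
    code is weakened by the decoding of the first.\<close>
  note r = renames_lift[OF ty_el[OF a(1)]]
  have "has_ty lg (El a # ?\<Gamma>) (lift_tm b) Univ"
    using has_ty_ren[OF b(1) r] by simp
  moreover have "eq_ty lg (El a # ?\<Gamma>) (El (lift_tm b)) (lift_ty (form_int Ks M \<psi>))"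
    using eq_ty_ren[OF b(2) r] by simp
  ultimately show ?case
    using a tm_csig el_sig eqty_sig eqty_trans ty_el unfolding form_int.simps prod_ty_def by meson
next
  case (Or \<phi> \<psi>)
  let ?\<Gamma> = "context_int Ks M \<Gamma>"
  obtain a b where "has_ty lg ?\<Gamma> a Univ" "eq_ty lg ?\<Gamma> (El a) (form_int Ks M \<phi>)"
    and "has_ty lg ?\<Gamma> b Univ" "eq_ty lg ?\<Gamma> (El b) (form_int Ks M \<psi>)"
    using Or by fastforce
  then show ?case
    using tm_csum el_sum eqty_sum eqty_trans unfolding form_int.simps by meson
next
  case (Imp \<phi> \<psi>)
  let ?\<Gamma> = "context_int Ks M \<Gamma>"
  obtain a b where a: "has_ty lg ?\<Gamma> a Univ" "eq_ty lg ?\<Gamma> (El a) (form_int Ks M \<phi>)"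
    and b: "has_ty lg ?\<Gamma> b Univ" "eq_ty lg ?\<Gamma> (El b) (form_int Ks M \<psi>)"
    using Imp by fastforce
  note r = renames_lift[OF ty_el[OF a(1)]]
  have "has_ty lg (El a # ?\<Gamma>) (lift_tm b) Univ"
    using has_ty_ren[OF b(1) r] by simp
  moreover have "eq_ty lg (El a # ?\<Gamma>) (El (lift_tm b)) (lift_ty (form_int Ks M \<psi>))"
    using eq_ty_ren[OF b(2) r] by simp
  ultimately show ?case
    using a tm_cpi el_pi eqty_pi eqty_trans ty_el unfolding form_int.simps fun_ty_def by meson
next
  case (Forall S \<phi>)
  let ?\<Gamma> = "context_int Ks M \<Gamma>"
  \<comment> \<open>An interpreted sort is literally \<open>El\<close> of a code, so the extended
    context of the induction hypothesis is already the one in the rule for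
    \<open>CPi\<close>.\<close>
  obtain a where a: "has_ty lg ?\<Gamma> a Univ" "sort_int Ks M S = El a"
    using has_ty_sort_code[OF is_ctx_context_int] Forall.prems by (cases S) fastforce
  obtain b where "has_ty lg (El a # ?\<Gamma>) b Univ" "eq_ty lg (El a # ?\<Gamma>) (El b) (form_int Ks M \<phi>)"
    using Forall.IH[of "S # \<Gamma>"] Forall.prems a(2) by (auto simp: context_int_Cons)
  then show ?case
    using a tm_cpi el_pi eqty_pi eqty_trans ty_el eqty_refl unfolding form_int.simps by metis
next
  case (Exists S \<phi>)
  let ?\<Gamma> = "context_int Ks M \<Gamma>"
  obtain a where a: "has_ty lg ?\<Gamma> a Univ" "sort_int Ks M S = El a"
    using has_ty_sort_code[OF is_ctx_context_int] Exists.prems by (cases S) fastforce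
  obtain b where "has_ty lg (El a # ?\<Gamma>) b Univ" "eq_ty lg (El a # ?\<Gamma>) (El b) (form_int Ks M \<phi>)"
    using Exists.IH[of "S # \<Gamma>"] Exists.prems a(2) by (auto simp: context_int_Cons)
  then show ?case
    using a tm_csig el_sig eqty_sig eqty_trans ty_el eqty_refl unfolding form_int.simps by metis
qed

lemma form_excluded_middle:
  assumes "lg = Classical" "wf_context L \<Gamma>" "form_in L \<Gamma> \<phi>"
  shows "inhabited lg (context_int Ks M \<Gamma>) (form_int Ks M (Or \<phi> (Imp \<phi> Bot)))"
proof -
  let ?\<Gamma> = "context_int Ks M \<Gamma>"
  note ctx = is_ctx_context_int[OF assms(2)]
  obtain a where a: "has_ty lg ?\<Gamma> a Univ" "eq_ty lg ?\<Gamma> (El a) (form_int Ks M \<phi>)"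
    using form_code assms by blast
  have "is_ty lg (El a # ?\<Gamma>) EmptyT"
    using a(1) by (blast intro: ty_empty is_ctx_lift ty_el)
  then have "eq_ty lg ?\<Gamma> (fun_ty (El a) EmptyT) (fun_ty (form_int Ks M \<phi>) EmptyT)"
    unfolding fun_ty_def using eqty_pi[OF ty_el[OF a(1)] a(2)] eqty_refl by simp
  then have "eq_ty lg ?\<Gamma> (SumT (El a) (fun_ty (El a) EmptyT)) (form_int Ks M (Or \<phi> (Imp \<phi> Bot)))"
    using eqty_sum[OF a(2)] by simp
  moreover have "has_ty lg ?\<Gamma> (App Lem a) (SumT (El a) (fun_ty (El a) EmptyT))"
    using tm_app[OF tm_lem[OF assms(1) ctx, unfolded lem_ty_def] a(1)]
    by (simp add: inst_ty_def)
  ultimately show ?thesis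
    using tm_conv inhabitedI by blast
qed

lemma satisfies_iff:
  "wf_sequent L (Sequent \<Gamma> \<phi> \<psi>) \<Longrightarrow> satisfies lg Ks M (Sequent \<Gamma> \<phi> \<psi>) \<longleftrightarrow>
    inhabited lg (context_int Ks M \<Gamma>) (fun_ty (form_int Ks M \<phi>) (form_int Ks M \<psi>))"
  using inhabited_pis_iff[OF is_ctx_context_int] by (simp add: inhabited_def)

lemma renames_context_int:
  assumes "wf_context L \<Gamma>"
    and "\<And>i. i < length \<Delta> \<Longrightarrow> declared \<Gamma> (\<rho> i) (ren_sort (\<lambda>j. \<rho> (j + Suc i)) (\<Delta> ! i))"
  shows "renames lg (context_int Ks M \<Gamma>) \<rho> (context_int Ks M \<Delta>)"
  using assms is_ctx_context_int[OF assms(1)]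
  by (auto simp: renames_def context_int_def declared_def)

text \<open>The last assumption is the condition of \<open>context_morphism\<close>, stated for a
  function so that \<open>Suc\<close> and \<open>swap\<close> fit as well as a list of
  variables.\<close>

lemma satisfies_ren:
  assumes "satisfies lg Ks M (Sequent \<Delta> \<phi> \<psi>)" "wf_sequent L (Sequent \<Delta> \<phi> \<psi>)"
    and "wf_sequent L (Sequent \<Gamma> (ren_form \<rho> \<phi>) (ren_form \<rho> \<psi>))"
    and "\<And>i. i < length \<Delta> \<Longrightarrow> declared \<Gamma> (\<rho> i) (ren_sort (\<lambda>j. \<rho> (j + Suc i)) (\<Delta> ! i))"
  shows "satisfies lg Ks M (Sequent \<Gamma> (ren_form \<rho> \<phi>) (ren_form \<rho> \<psi>))"
proof -
  have "renames lg (context_int Ks M \<Gamma>) \<rho> (context_int Ks M \<Delta>)"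
    using assms(3,4) by (intro renames_context_int) auto
  from inhabited_ren[OF _ this] show ?thesis
    using assms(1) unfolding satisfies_iff[OF assms(2)] satisfies_iff[OF assms(3)] by fastforce
qed

end

section \<open>Exchange as a renaming of contexts\<close>

lemma length_swap_context [simp]: "length (swap_context \<Delta>) = length \<Delta>"
  by (induction \<Delta>) simp_all

lemma swap_context_nth:
  "i < length \<Delta> \<Longrightarrow> swap_context \<Delta> ! i = ren_sort (swap (length \<Delta> - Suc i)) (\<Delta> ! i)"
  by (induction \<Delta> arbitrary: i) (auto simp: nth_Cons split: nat.split)

lemma exchange_declared:
  assumes "i < length (\<Delta> @ lift_sort K' # K # \<Gamma>)"
  shows "declared (swap_context \<Delta> @ lift_sort K # K' # \<Gamma>) (swap (length \<Delta>) i)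
    (ren_sort (\<lambda>j. swap (length \<Delta>) (j + Suc i)) ((\<Delta> @ lift_sort K' # K # \<Gamma>) ! i))"
proof -
  let ?n = "length \<Delta>"
  consider "i < ?n" | "i = ?n" | "i = Suc ?n" | "i > Suc ?n"
    by linarith
  then show ?thesis
  proof cases
    case 1
    \<comment> \<open>Seen from the later declaration \<open>i\<close>, the exchanged pair is nearer
      by \<open>Suc i\<close>; this is the shifted exchange that \<open>swap_context\<close>
      performs on its sort.\<close>
    have "(\<lambda>j. swap ?n (j + Suc i)) = (\<lambda>j. swap (?n - Suc i) j + Suc i)"
      using 1 by (intro ext) (auto simp: swap_def)
    then show ?thesis
      using 1 by (simp add: declared_def nth_append swap_context_nth) (simp add: swap_def)
  next
    case 4
    then have "i - ?n = Suc (Suc (i - Suc (Suc ?n)))" "i < Suc (Suc (?n + length \<Gamma>))"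
      using assms by auto
    then show ?thesis
      using 4 by (simp add: declared_def nth_append swap_def)
  qed (simp_all add: declared_def nth_append swap_def)
qed

lemma deriv_imp_wf_sequent: "deriv lg L S \<tau> \<Longrightarrow> wf_sequent L \<tau>"
  by (induction rule: deriv.induct) auto

section \<open>Soundness of each rule in a fixed structure\<close>

context folds_structure
begin

lemma is_ty_wf_sequent:
  assumes "wf_sequent L (Sequent \<Gamma> \<phi> \<psi>)"
  shows "is_ty lg (context_int Ks M \<Gamma>) (form_int Ks M \<phi>)"
    "is_ty lg (context_int Ks M \<Gamma>) (form_int Ks M \<psi>)"
  using assms is_ty_form by auto

lemma satisfies_derivD:
  assumes "deriv lg L S (Sequent \<Gamma> \<phi> \<psi>)" "satisfies lg Ks M (Sequent \<Gamma> \<phi> \<psi>)"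
  shows "inhabited lg (context_int Ks M \<Gamma>) (fun_ty (form_int Ks M \<phi>) (form_int Ks M \<psi>))"
  using assms satisfies_iff deriv_imp_wf_sequent by blast

lemma soundness:
  assumes "deriv lg L S \<tau>" "\<forall>\<sigma>\<in>S. satisfies lg Ks M \<sigma>"
  shows "satisfies lg Ks M \<tau>"
  using assms(1)
proof (induction rule: deriv.induct)
  case (axm \<sigma>)
  then show ?case using assms(2) by blast
next
  case (substitution \<Delta> \<phi> \<psi> \<Gamma> ys)
  show ?case
    using substitution.IH deriv_imp_wf_sequent[OF substitution.hyps(1)] substitution.hyps(3)
    by (rule satisfies_ren) (use substitution.hyps(2) in \<open>simp add: context_morphism_def\<close>)
next
  case (weakening \<Gamma> \<phi> \<psi> K)
  show ?case
    using weakening.IH deriv_imp_wf_sequent[OF weakening.hyps(1)] weakening.hyps(2)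
    by (rule satisfies_ren) (simp add: declared_def)
next
  case (exchange \<Delta> K' K \<Gamma> \<phi> \<psi>)
  show ?case
    using exchange.IH deriv_imp_wf_sequent[OF exchange.hyps(1)] exchange.hyps(2) exchange_declared
    by (rule satisfies_ren)
next
  case (identity \<Gamma> \<phi>)
  show ?case
    unfolding satisfies_iff[OF identity.hyps(1)]
    using is_ty_wf_sequent[OF identity.hyps(1)]
    by (simp add: ent_refl)
next
  case (cut \<Gamma> \<phi> \<psi> \<theta>)
  show ?case
    unfolding satisfies_iff[OF cut.hyps(3)]
    using is_ty_wf_sequent[OF cut.hyps(3)]
      satisfies_derivD[OF cut.hyps(1) cut.IH(1)] satisfies_derivD[OF cut.hyps(2) cut.IH(2)]
    by (blast intro: ent_trans)
next
  case (top \<Gamma> \<phi>)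
  show ?case
    unfolding satisfies_iff[OF top.hyps(1)]
    using is_ty_wf_sequent[OF top.hyps(1)]
    by (simp add: ent_top)
next
  case (bot \<Gamma> \<phi>)
  show ?case
    unfolding satisfies_iff[OF bot.hyps(1)]
    using is_ty_wf_sequent[OF bot.hyps(1)]
    by (simp add: ent_bot)
next
  case (ex_top \<Gamma> K \<phi>)
  then have "is_ty lg (context_int Ks M \<Gamma>) (sort_int Ks M K)"
    "is_ty lg (sort_int Ks M K # context_int Ks M \<Gamma>) (form_int Ks M \<phi>)"
    using is_ty_form[of "K # \<Gamma>" \<phi>]
    by (auto intro: is_ty_sort is_ctx_context_int simp: context_int_Cons)
  from ent_ex_top[OF this] show ?case
    unfolding satisfies_iff[OF ex_top] by simp
next
  case (and_intro \<Gamma> \<theta> \<phi> \<psi>)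
  show ?case
    unfolding satisfies_iff[OF and_intro.hyps(3)]
    using is_ty_wf_sequent[OF and_intro.hyps(3)]
      satisfies_derivD[OF and_intro.hyps(1) and_intro.IH(1)] satisfies_derivD[OF and_intro.hyps(2) and_intro.IH(2)]
      is_ty_wf_sequent[OF deriv_imp_wf_sequent[OF and_intro.hyps(1)]]
      is_ty_wf_sequent[OF deriv_imp_wf_sequent[OF and_intro.hyps(2)]]
    by (simp add: ent_and_intro)
next
  case (and_left \<Gamma> \<theta> \<phi> \<psi>)
  \<comment> \<open>The discarded conjunct does not occur in the conclusion, so its well-formedness
    is recovered from the derivation of the premise.\<close>
  have "is_ty lg (context_int Ks M \<Gamma>) (form_int Ks M \<phi>)" "is_ty lg (context_int Ks M \<Gamma>) (form_int Ks M \<psi>)"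
    using deriv_imp_wf_sequent[OF and_left.hyps(1)] by (auto intro: is_ty_form)
  then show ?case
    unfolding satisfies_iff[OF and_left.hyps(2)]
    using is_ty_wf_sequent[OF and_left.hyps(2)] satisfies_derivD[OF and_left.hyps(1) and_left.IH]
    by (auto intro: ent_trans ent_fst)
next
  case (and_right \<Gamma> \<theta> \<phi> \<psi>)
  have "is_ty lg (context_int Ks M \<Gamma>) (form_int Ks M \<phi>)" "is_ty lg (context_int Ks M \<Gamma>) (form_int Ks M \<psi>)"
    using deriv_imp_wf_sequent[OF and_right.hyps(1)] by (auto intro: is_ty_form)
  then show ?case
    unfolding satisfies_iff[OF and_right.hyps(2)]
    using is_ty_wf_sequent[OF and_right.hyps(2)] satisfies_derivD[OF and_right.hyps(1) and_right.IH]
    by (auto intro: ent_trans ent_snd)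
next
  case (or_elim \<Gamma> \<phi> \<theta> \<psi>)
  show ?case
    unfolding satisfies_iff[OF or_elim.hyps(3)]
    using is_ty_wf_sequent[OF or_elim.hyps(3)]
      satisfies_derivD[OF or_elim.hyps(1) or_elim.IH(1)] satisfies_derivD[OF or_elim.hyps(2) or_elim.IH(2)]
      is_ty_wf_sequent[OF deriv_imp_wf_sequent[OF or_elim.hyps(1)]]
      is_ty_wf_sequent[OF deriv_imp_wf_sequent[OF or_elim.hyps(2)]]
    by (simp add: ent_or_elim)
next
  case (or_left \<Gamma> \<phi> \<psi> \<theta>)
  have "is_ty lg (context_int Ks M \<Gamma>) (form_int Ks M \<phi>)" "is_ty lg (context_int Ks M \<Gamma>) (form_int Ks M \<psi>)"
    using deriv_imp_wf_sequent[OF or_left.hyps(1)] by (auto intro: is_ty_form)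
  then show ?case
    unfolding satisfies_iff[OF or_left.hyps(2)]
    using satisfies_derivD[OF or_left.hyps(1) or_left.IH]
    by (auto intro: ent_trans ent_inl)
next
  case (or_right \<Gamma> \<phi> \<psi> \<theta>)
  have "is_ty lg (context_int Ks M \<Gamma>) (form_int Ks M \<phi>)" "is_ty lg (context_int Ks M \<Gamma>) (form_int Ks M \<psi>)"
    using deriv_imp_wf_sequent[OF or_right.hyps(1)] by (auto intro: is_ty_form)
  then show ?case
    unfolding satisfies_iff[OF or_right.hyps(2)]
    using satisfies_derivD[OF or_right.hyps(1) or_right.IH]
    by (auto intro: ent_trans ent_inr)
next
  case (imp_intro \<Gamma> \<theta> \<phi> \<psi>)
  have "is_ty lg (context_int Ks M \<Gamma>) (form_int Ks M \<theta>)" "is_ty lg (context_int Ks M \<Gamma>) (form_int Ks M \<phi>)"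
    using imp_intro.hyps(2) by (auto intro: is_ty_form)
  then show ?case
    unfolding satisfies_iff[OF imp_intro.hyps(2)]
    using satisfies_derivD[OF imp_intro.hyps(1) imp_intro.IH]
    by (simp add: ent_curry)
next
  case (imp_elim \<Gamma> \<theta> \<phi> \<psi>)
  have "is_ty lg (context_int Ks M \<Gamma>) (form_int Ks M \<theta>)" "is_ty lg (context_int Ks M \<Gamma>) (form_int Ks M \<phi>)"
    using imp_elim.hyps(2) by (auto intro: is_ty_form)
  then show ?case
    unfolding satisfies_iff[OF imp_elim.hyps(2)]
    using satisfies_derivD[OF imp_elim.hyps(1) imp_elim.IH]
    by (simp add: ent_uncurry)
next
  case (all_intro K \<Gamma> \<theta> \<phi>)
  have "is_ty lg (context_int Ks M \<Gamma>) (form_int Ks M \<theta>)" "is_ty lg (context_int Ks M \<Gamma>) (sort_int Ks M K)"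
    using all_intro.hyps(2) is_ty_form[of "K # \<Gamma>" \<phi>]
    by (auto intro: is_ty_form is_ty_sort is_ctx_context_int simp: context_int_Cons)
  from ent_all_intro[OF this, of "form_int Ks M \<phi>"] show ?case
    unfolding satisfies_iff[OF all_intro.hyps(2)]
    using satisfies_derivD[OF all_intro.hyps(1) all_intro.IH] by (simp add: context_int_Cons)
next
  case (all_elim \<Gamma> \<theta> K \<phi>)
  have "is_ty lg (context_int Ks M \<Gamma>) (form_int Ks M \<theta>)" "is_ty lg (context_int Ks M \<Gamma>) (sort_int Ks M K)"
    using deriv_imp_wf_sequent[OF all_elim.hyps(1)] is_ty_form[of "K # \<Gamma>" \<phi>]
    by (auto intro: is_ty_form is_ty_sort is_ctx_context_int simp: context_int_Cons)
  from ent_all_elim[OF this, of "form_int Ks M \<phi>"] show ?case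
    unfolding satisfies_iff[OF all_elim.hyps(2)]
    using satisfies_derivD[OF all_elim.hyps(1) all_elim.IH] by (simp add: context_int_Cons)
next
  case (ex_elim K \<Gamma> \<phi> \<theta>)
  have "is_ty lg (context_int Ks M \<Gamma>) (sort_int Ks M K)"
    "is_ty lg (sort_int Ks M K # context_int Ks M \<Gamma>) (form_int Ks M \<phi>)"
    using ex_elim.hyps(2) is_ty_form[of "K # \<Gamma>" \<phi>]
    by (auto intro: is_ty_form is_ty_sort is_ctx_context_int simp: context_int_Cons)
  from ent_ex_elim[OF this, of "form_int Ks M \<theta>"] show ?case
    unfolding satisfies_iff[OF ex_elim.hyps(2)]
    using satisfies_derivD[OF ex_elim.hyps(1) ex_elim.IH] by (simp add: context_int_Cons)
next
  case (ex_intro \<Gamma> K \<phi> \<theta>)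
  have "is_ty lg (context_int Ks M \<Gamma>) (sort_int Ks M K)"
    "is_ty lg (sort_int Ks M K # context_int Ks M \<Gamma>) (form_int Ks M \<phi>)"
    using deriv_imp_wf_sequent[OF ex_intro.hyps(1)] is_ty_form[of "K # \<Gamma>" \<phi>]
    by (auto intro: is_ty_form is_ty_sort is_ctx_context_int simp: context_int_Cons)
  from ent_ex_intro[OF this, of "form_int Ks M \<theta>"] show ?case
    unfolding satisfies_iff[OF ex_intro.hyps(2)]
    using satisfies_derivD[OF ex_intro.hyps(1) ex_intro.IH] by (simp add: context_int_Cons)
next
  case (frobenius \<Gamma> \<phi> K \<psi>)
  then have "is_ty lg (context_int Ks M \<Gamma>) (form_int Ks M \<phi>)" "is_ty lg (context_int Ks M \<Gamma>) (sort_int Ks M K)"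
    "is_ty lg (sort_int Ks M K # context_int Ks M \<Gamma>) (form_int Ks M \<psi>)"
    using is_ty_form[of "K # \<Gamma>" \<psi>]
    by (auto intro: is_ty_form is_ty_sort is_ctx_context_int simp: context_int_Cons)
  from ent_frobenius[OF this] show ?case
    unfolding satisfies_iff[OF frobenius] by simp
next
  case (distributivity \<Gamma> \<phi> \<psi> \<theta>)
  then show ?case
    unfolding satisfies_iff[OF distributivity] by (auto intro: ent_distributivity is_ty_form)
next
  case (excluded_middle \<Gamma> \<phi>)
  have wf: "wf_context L \<Gamma>" "form_in L \<Gamma> \<phi>"
    using excluded_middle.hyps(2) by simp_all
  have u: "is_ty lg (context_int Ks M \<Gamma>) UnitT"
    using ty_unit[OF is_ctx_context_int[OF wf(1)]] .
  \<comment> \<open>The inhabitant of the disjunction is weakened past the hypothesis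
    \<open>UnitT\<close> and abstracted to a constant function.\<close>
  show ?case
    unfolding satisfies_iff[OF excluded_middle.hyps(2)]
    using inhabited_fun[OF u] inhabited_lift[OF form_excluded_middle u] excluded_middle.hyps(1) wf by simp
qed

end

theorem theorem2p25:
  fixes L :: "('o, 'a) signature"
    and Ks :: "'o list"
    and T :: "'o sequent set"
    and \<tau> :: "'o sequent"
  assumes "folds_signature L"
    and "finite_signature L"
    and "increasing_listing (obj_less L) (Obj L) Ks"
    and "\<forall>\<sigma>\<in>T. wf_sequent L \<sigma>"
    and "wf_sequent L \<tau>"
  shows "(derives Intuitionistic L T \<tau> \<longrightarrow> entails Intuitionistic L Ks T \<tau>) \<and>
    (derives Classical L T \<tau> \<longrightarrow> entails Classical L Ks T \<tau>)"
proof -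
  \<comment> \<open>The logic stays arbitrary, so that one argument yields both halves.\<close>
  have "entails lg L Ks T \<tau>" if d: "derives lg L T \<tau>" for lg
    unfolding entails_def
  proof (intro allI impI)
    fix M
    assume "is_structure lg L Ks M" and sat: "\<forall>\<sigma>\<in>T. satisfies lg Ks M \<sigma>"
    then interpret folds_structure lg L Ks M
      using assms by unfold_locales
    show "satisfies lg Ks M \<tau>"
      using d sat soundness unfolding derives_def by blast
  qed
  then show ?thesis
    by blast
qed

end
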